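(* Let $f:\mathbb{R}\to\mathbb{R}_{\mathcal{F}}$ be a $2\pi$-periodic continuous fuzzy valued function with $[f(x)]_\alpha=[f^-_\alpha(x),f^+_\alpha(x)]$. For each sign $\mp$, $\alpha\in[0,1]$ and $x\in\mathbb{R}$, let $$\dot f_0^{\mp}(\alpha,x)=\frac{a_0^{\mp}(\alpha)}{2},\qquad \dot f_n^{\mp}(\alpha,x)=a_n^{\mp}(\alpha)\cos(nx)+b_n^{\mp}(\alpha)\sin(nx)\quad(n\ge1)$$ be the terms of the left ($-$) and right ($+$) level Fourier series of $f$. Then for every $s>0$ and $x\in\mathbb{R}$, the pair of $(A,n)$ means $\sum_{n=0}^\infty\dot f_n^{\mp}(\alpha,x)e^{-ns}$, $\alpha\in[0,1]$, represents a fuzzy number, i.e. these are the left and right endpoints of the $\alpha$-level sets of a fuzzy number; this fuzzy number is $$\frac{1-e^{-2s}}{2\pi}\int_{-\pi}^{\pi}\frac{f(x-t)\,dt}{1-2e^{-s}\cos t+e^{-2s}},$$ and for every $x\in\mathbb{R}$ $$\lim_{s\to 0^+}\frac{1-e^{-2s}}{2\pi}\int_{-\pi}^{\pi}\frac{f(x-t)\,dt}{1-2e^{-s}\cos t+e^{-2s}}=f(x).$$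
   Context: A fuzzy number is a function $u:\mathbb{R}\to[0,1]$ that is normal ($u(t_0)=1$ for some $t_0$), fuzzy convex ($u(\theta t+(1-\theta)t')\ge\min\{u(t),u(t')\}$ for all $t,t'\in\mathbb{R}$, $\theta\in[0,1]$), upper semicontinuous, and has compact support $\overline{\{t\in\mathbb{R}:u(t)>0\}}$. $\mathbb{R}_{\mathcal{F}}$ denotes the set of fuzzy numbers. The $\alpha$-level sets are $[u]_\alpha=\{t:u(t)\ge\alpha\}$ for $0<\alpha\le1$ and $[u]_0=\overline{\{t:u(t)>0\}}$; they are compact intervals, written $[u]_\alpha=[u^-_\alpha,u^+_\alpha]$. Operations are levelwise: $[u+v]_\alpha=[u^-_\alpha+v^-_\alpha,u^+_\alpha+v^+_\alpha]$, and for $k\in\mathbb{R}$, $[ku]_\alpha=[ku^-_\alpha,ku^+_\alpha]$ if $k\ge0$ and $[ku]_\alpha=[ku^+_\alpha,ku^-_\alpha]$ if $k<0$. The metric on $\mathbb{R}_{\mathcal{F}}$ is $D(u,v)=\sup_{\alpha\in[0,1]}\max\{|u^-_\alpha-v^-_\alpha|,|u^+_\alpha-v^+_\alpha|\}$. Continuity of fuzzy valued functions and limits of fuzzy numbers are with respect to $D$. A function $f:\mathbb{R}\to\mathbb{R}_{\mathcal{F}}$ is $2\pi$-periodic if $f(x+2\pi)=f(x)$ for all $x$. Integrals of fuzzy valued functions are in the fuzzy Riemann sense: $I\in\mathbb{R}_{\mathcal{F}}$ is the integral of $g:[a,b]\to\mathbb{R}_{\mathcal{F}}$ if for every $\varepsilon>0$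 there is $\delta>0$ such that $D\left(\sum_i(t_{i}-t_{i-1})g(\xi_i),I\right)<\varepsilon$ for every tagged partition of $[a,b]$ with points $t_i$, tags $\xi_i\in[t_{i-1},t_i]$ and mesh less than $\delta$. Level Fourier series: for a $2\pi$-periodic continuous fuzzy valued function $f$, the level Fourier series of $f$ is the pair of real series (left for the sign $-$, right for the sign $+$) $\frac{a^{\mp}_0(\alpha)}{2}+\sum_{n=1}^{\infty}\left(a_n^{\mp}(\alpha)\cos(nx)+b^{\mp}_n(\alpha)\sin(nx)\right)$, where $a^{\mp}_0(\alpha)=\frac{1}{\pi}\int_{-\pi}^{\pi}f^{\mp}_{\alpha}(x)\,dx$, $a^{\mp}_n(\alpha)=\frac{1}{\pi}\int_{-\pi}^{\pi}f^{\mp}_{\alpha}(x)\cos(nx)\,dx$ and $b^{\mp}_n(\alpha)=\frac{1}{\pi}\int_{-\pi}^{\pi}f^{\mp}_{\alpha}(x)\sin(nx)\,dx$. The $(A,n)$ mean of a series $\sum_{n\ge0} c_n$ is $\sum_{n=0}^\infty c_ne^{-ns}$, $s>0$ (the generalized Dirichlet mean $\sum c_ne^{-\lambda_ns}$ with $\lambda_n=n$). *)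

theory Defs
  imports "HOL-Analysis.Analysis"
begin

section \<open>Fuzzy numbers and their level sets\<close>

definition upper_semicontinuous :: "(real \<Rightarrow> real) \<Rightarrow> bool" where
  "upper_semicontinuous u \<longleftrightarrow> (\<forall>t. \<forall>e>0. \<forall>\<^sub>F y in nhds t. u y < u t + e)"

definition fuzzy_convex :: "(real \<Rightarrow> real) \<Rightarrow> bool" where
  "fuzzy_convex u \<longleftrightarrow>
     (\<forall>t t'. \<forall>\<theta>\<in>{0..1}. min (u t) (u t') \<le> u (\<theta> * t + (1 - \<theta>) * t'))"

definition is_fuzzy_number :: "(real \<Rightarrow> real) \<Rightarrow> bool" where
  "is_fuzzy_number u \<longleftrightarrow>
     (\<forall>t. u t \<in> {0..1}) \<and> (\<exists>t. u t = 1) \<and> fuzzy_convex u \<and>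
     upper_semicontinuous u \<and> compact (closure {t. u t > 0})"

lemma is_fuzzy_number_indicator: "is_fuzzy_number (indicator {c})"
proof -
  have "upper_semicontinuous (indicator {c})"
    unfolding upper_semicontinuous_def
  proof (intro allI impI)
    fix t e :: real assume e: "e > 0"
    show "\<forall>\<^sub>F y in nhds t. indicator {c} y < indicator {c} t + e"
    proof (cases "t = c")
      case True
      then show ?thesis using e by (auto simp: indicator_def)
    next
      case False
      then have "\<forall>\<^sub>F y in nhds t. y \<noteq> c" by (rule t1_space_nhds)
      then show ?thesis
        by eventually_elim (use e in \<open>auto simp: indicator_def\<close>)
    qed
  qed
  moreover have "fuzzy_convex (indicator {c})"
    by (auto simp: fuzzy_convex_def indicator_def algebra_simps)
  moreover have "{t. indicator {c} t > (0::real)} = {c}"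
    by (auto simp: indicator_def)
  ultimately show ?thesis
    by (auto simp: is_fuzzy_number_def indicator_def)
qed

typedef fuzzy = "{u. is_fuzzy_number u}"
  morphisms membership Abs_fuzzy
  using is_fuzzy_number_indicator by blast

text \<open>Only \<open>\<alpha> \<in> {0..1}\<close> is meaningful in the following three definitions.\<close>

definition level :: "fuzzy \<Rightarrow> real \<Rightarrow> real set" where
  "level u \<alpha> =
     (if \<alpha> = 0 then closure {t. membership u t > 0} else {t. membership u t \<ge> \<alpha>})"

definition lower :: "fuzzy \<Rightarrow> real \<Rightarrow> real" where
  "lower u \<alpha> = Inf (level u \<alpha>)"

definition upper :: "fuzzy \<Rightarrow> real \<Rightarrow> real" where
  "upper u \<alpha> = Sup (level u \<alpha>)"

lemma membership_props:
  shows membership_range: "0 \<le> membership u t" "membership u t \<le> 1"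
    and membership_normal: "\<exists>t. membership u t = 1"
    and membership_convex: "fuzzy_convex (membership u)"
    and membership_usc: "upper_semicontinuous (membership u)"
    and membership_support: "compact (closure {t. membership u t > 0})"
  using membership[of u] by (auto simp: is_fuzzy_number_def)

lemma level_anti:
  assumes "0 \<le> \<alpha>" "\<alpha> \<le> \<beta>"
  shows "level u \<beta> \<subseteq> level u \<alpha>"
  using assms by (auto simp: level_def intro!: subsetD[OF closure_subset])

lemma level_nonempty:
  assumes "\<alpha> \<le> 1"
  shows "level u \<alpha> \<noteq> {}"
proof -
  obtain t where t: "membership u t = 1" using membership_normal by blast
  then have "t \<in> level u \<alpha>"
    using assms closure_subset[of "{t. membership u t > 0}"] by (force simp: level_def)
  then show ?thesis by blast
qed

lemma level_closed: "closed (level u \<alpha>)"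
proof (cases "\<alpha> = 0")
  case False
  have "open (- {t. membership u t \<ge> \<alpha>})"
    unfolding open_subopen[of "- {t. membership u t \<ge> \<alpha>}"]
  proof
    fix t assume "t \<in> - {t. membership u t \<ge> \<alpha>}"
    then have "\<alpha> - membership u t > 0" by simp
    then have "\<forall>\<^sub>F y in nhds t. membership u y < membership u t + (\<alpha> - membership u t)"
      using membership_usc[of u] unfolding upper_semicontinuous_def by blast
    then show "\<exists>T. open T \<and> t \<in> T \<and> T \<subseteq> - {t. membership u t \<ge> \<alpha>}"
      unfolding eventually_nhds by (auto simp: not_le subset_eq)
  qed
  then show ?thesis using False by (simp add: level_def closed_def)
qed (simp add: level_def)

lemma level_compact:
  assumes "0 \<le> \<alpha>"
  shows "compact (level u \<alpha>)"
proof -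
  have "compact (level u 0)" using membership_support[of u] by (simp add: level_def)
  then have "compact (level u 0 \<inter> level u \<alpha>)" using level_closed by (rule compact_Int_closed)
  moreover have "level u 0 \<inter> level u \<alpha> = level u \<alpha>" using level_anti[of 0 \<alpha> u] assms by blast
  ultimately show ?thesis by simp
qed

lemma level_convex: "convex (level u \<alpha>)"
proof -
  have min: "min (membership u x) (membership u y) \<le> membership u (p * x + q * y)"
    if "0 \<le> p" "0 \<le> q" "p + q = 1" for x y p q :: real
  proof -
    have "q = 1 - p" "p \<in> {0..1}" using that by auto
    then show ?thesis using membership_convex[of u] unfolding fuzzy_convex_def by blast
  qed
  have "membership u (p * x + q * y) > 0"
    if "membership u x > 0" "membership u y > 0" "0 \<le> p" "0 \<le> q" "p + q = 1" for x y p q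
    using min[OF that(3-5), of x y] that(1,2) by linarith
  then have "convex {t. membership u t > 0}"
    by (auto simp: convex_def)
  moreover have "membership u (p * x + q * y) \<ge> \<alpha>"
    if "membership u x \<ge> \<alpha>" "membership u y \<ge> \<alpha>" "0 \<le> p" "0 \<le> q" "p + q = 1" for x y p q
    using min[OF that(3-5), of x y] that(1,2) by linarith
  then have "convex {t. membership u t \<ge> \<alpha>}"
    by (auto simp: convex_def)
  ultimately show ?thesis by (simp add: level_def convex_closure)
qed

lemma level_eq_interval:
  assumes "\<alpha> \<in> {0..1}"
  shows "level u \<alpha> = {lower u \<alpha>..upper u \<alpha>}" and "lower u \<alpha> \<le> upper u \<alpha>"
proof -
  have "connected (level u \<alpha>)" "compact (level u \<alpha>)" "level u \<alpha> \<noteq> {}"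
    using assms level_convex level_compact level_nonempty by (auto intro: convex_connected)
  then obtain a b where ab: "level u \<alpha> = {a..b}" "a \<le> b"
    using connected_compact_interval_1[of "level u \<alpha>"] by auto
  then show "level u \<alpha> = {lower u \<alpha>..upper u \<alpha>}" "lower u \<alpha> \<le> upper u \<alpha>"
    by (simp_all add: lower_def upper_def)
qed

lemma lower_mono:
  assumes "0 \<le> \<alpha>" "\<alpha> \<le> \<beta>" "\<beta> \<le> 1"
  shows "lower u \<alpha> \<le> lower u \<beta>"
  using level_anti[OF assms(1,2), of u] level_eq_interval[of \<alpha> u] level_eq_interval[of \<beta> u] assms
  by auto

lemma upper_anti:
  assumes "0 \<le> \<alpha>" "\<alpha> \<le> \<beta>" "\<beta> \<le> 1"
  shows "upper u \<beta> \<le> upper u \<alpha>"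
  using level_anti[OF assms(1,2), of u] level_eq_interval[of \<alpha> u] level_eq_interval[of \<beta> u] assms
  by auto

lemma fuzzy_eqI:
  assumes "\<And>\<alpha>. \<alpha> \<in> {0..1} \<Longrightarrow> lower u \<alpha> = lower v \<alpha>"
    and "\<And>\<alpha>. \<alpha> \<in> {0..1} \<Longrightarrow> upper u \<alpha> = upper v \<alpha>"
  shows "u = v"
proof -
  have lev: "level u \<alpha> = level v \<alpha>" if "\<alpha> \<in> {0..1}" for \<alpha>
    using level_eq_interval(1)[OF that] assms that by simp
  have le: "membership u t \<le> membership v t"
    if l: "\<And>\<alpha>. \<alpha> \<in> {0..1} \<Longrightarrow> level u \<alpha> = level v \<alpha>" for u v t
  proof (cases "membership u t = 0")
    case False
    then have "t \<in> level v (membership u t)"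
      using l[of "membership u t"] membership_range[where u = u and t = t]
      by (auto simp: level_def)
    then show ?thesis using False by (simp add: level_def)
  qed (simp add: membership_range)
  have "membership u t = membership v t" for t
    by (rule antisym) (rule le, simp add: lev)+
  then show ?thesis by (simp add: ext membership_inject[symmetric])
qed

section \<open>The characterisation of families of level sets\<close>

lemma endpoints_left_continuous:
  assumes a: "0 < \<alpha>" "\<alpha> \<le> 1"
  shows "(lower u \<longlongrightarrow> lower u \<alpha>) (at_left \<alpha>)" and "(upper u \<longlongrightarrow> upper u \<alpha>) (at_left \<alpha>)"
proof -
  have ev: "\<forall>\<^sub>F \<beta> in at_left \<alpha>. max 0 c < \<beta> \<and> \<beta> < \<alpha>" if "c < \<alpha>" for c
    using that a by (auto simp: eventually_at_left[of 0] intro!: exI[of _ "max 0 c"])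
  have ev': "\<forall>\<^sub>F \<beta> in at_left \<alpha>. c \<notin> level u \<beta> \<and> 0 < \<beta> \<and> \<beta> < \<alpha>" if "c \<notin> level u \<alpha>" for c
  proof -
    have "membership u c < \<alpha>" using that a by (simp add: level_def)
    from ev[OF this] show ?thesis by eventually_elim (auto simp: level_def)
  qed
  note [simp] = level_eq_interval(1)
  show "(lower u \<longlongrightarrow> lower u \<alpha>) (at_left \<alpha>)"
  proof (rule order_tendstoI)
    fix c assume c: "c < lower u \<alpha>"
    then have "c \<notin> level u \<alpha>" using a by auto
    from ev'[OF this] show "\<forall>\<^sub>F \<beta> in at_left \<alpha>. c < lower u \<beta>"
    proof eventually_elim
      case (elim \<beta>)
      then show ?case
        using c upper_anti[of \<beta> \<alpha> u] level_eq_interval(2)[of \<alpha> u] a by auto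
    qed
  next
    fix c assume c: "lower u \<alpha> < c"
    from ev[OF a(1)] show "\<forall>\<^sub>F \<beta> in at_left \<alpha>. lower u \<beta> < c"
    proof eventually_elim
      case (elim \<beta>)
      then show ?case using c lower_mono[of \<beta> \<alpha> u] a by auto
    qed
  qed
  show "(upper u \<longlongrightarrow> upper u \<alpha>) (at_left \<alpha>)"
  proof (rule order_tendstoI)
    fix c assume c: "upper u \<alpha> < c"
    then have "c \<notin> level u \<alpha>" using a by auto
    from ev'[OF this] show "\<forall>\<^sub>F \<beta> in at_left \<alpha>. upper u \<beta> < c"
    proof eventually_elim
      case (elim \<beta>)
      then show ?case
        using c lower_mono[of \<beta> \<alpha> u] level_eq_interval(2)[of \<alpha> u] a by auto
    qed
  next
    fix c assume c: "c < upper u \<alpha>"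
    from ev[OF a(1)] show "\<forall>\<^sub>F \<beta> in at_left \<alpha>. c < upper u \<beta>"
    proof eventually_elim
      case (elim \<beta>)
      then show ?case using c upper_anti[of \<beta> \<alpha> u] a by auto
    qed
  qed
qed

lemma endpoints_right_continuous:
  shows "(lower u \<longlongrightarrow> lower u 0) (at_right 0)" and "(upper u \<longlongrightarrow> upper u 0) (at_right 0)"
proof -
  have ev: "\<forall>\<^sub>F \<beta> in at_right 0. 0 < \<beta> \<and> \<beta> \<le> min 1 c" if "0 < c" for c :: real
    using that by (auto simp: eventually_at_right[of 0 1] intro!: exI[of _ "min 1 c"])
  have ev': "\<forall>\<^sub>F \<beta> in at_right 0. 0 < \<beta> \<and> \<beta> \<le> 1 \<and> (\<exists>t\<in>level u \<beta>. dist t c < e)"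
    if c: "c \<in> level u 0" and e: "e > 0" for c e
  proof -
    obtain t where t: "membership u t > 0" "dist t c < e"
      using c e by (auto simp: level_def closure_approachable)
    from ev[OF t(1)] show ?thesis
      by eventually_elim (use t in \<open>auto simp: level_def\<close>)
  qed
  note [simp] = level_eq_interval(1)
  have in0: "lower u 0 \<in> level u 0" "upper u 0 \<in> level u 0"
    using level_eq_interval(2)[of 0 u] by auto
  show "(lower u \<longlongrightarrow> lower u 0) (at_right 0)"
  proof (rule order_tendstoI)
    fix c assume c: "c < lower u 0"
    from ev[of 1] have "\<forall>\<^sub>F \<beta> in at_right 0. 0 < \<beta> \<and> \<beta> \<le> (1::real)" by simp
    then show "\<forall>\<^sub>F \<beta> in at_right 0. c < lower u \<beta>"
    proof eventually_elim
      case (elim \<beta>)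
      then show ?case using c lower_mono[of 0 \<beta> u] by auto
    qed
  next
    fix c assume c: "lower u 0 < c"
    from ev'[OF in0(1), of "c - lower u 0"] c
    have "\<forall>\<^sub>F \<beta> in at_right 0. 0 < \<beta> \<and> \<beta> \<le> 1 \<and>
        (\<exists>t\<in>level u \<beta>. dist t (lower u 0) < c - lower u 0)"
      by simp
    then show "\<forall>\<^sub>F \<beta> in at_right 0. lower u \<beta> < c"
      by eventually_elim (auto simp: dist_real_def)
  qed
  show "(upper u \<longlongrightarrow> upper u 0) (at_right 0)"
  proof (rule order_tendstoI)
    fix c assume c: "upper u 0 < c"
    from ev[of 1] have "\<forall>\<^sub>F \<beta> in at_right 0. 0 < \<beta> \<and> \<beta> \<le> (1::real)" by simp
    then show "\<forall>\<^sub>F \<beta> in at_right 0. upper u \<beta> < c"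
    proof eventually_elim
      case (elim \<beta>)
      then show ?case using c upper_anti[of 0 \<beta> u] by auto
    qed
  next
    fix c assume c: "c < upper u 0"
    from ev'[OF in0(2), of "upper u 0 - c"] c
    have "\<forall>\<^sub>F \<beta> in at_right 0. 0 < \<beta> \<and> \<beta> \<le> 1 \<and>
        (\<exists>t\<in>level u \<beta>. dist t (upper u 0) < upper u 0 - c)"
      by simp
    then show "\<forall>\<^sub>F \<beta> in at_right 0. c < upper u \<beta>"
      by eventually_elim (auto simp: dist_real_def)
  qed
qed

theorem fuzzy_from_endpoints:
  fixes L R :: "real \<Rightarrow> real"
  assumes LR: "L 1 \<le> R 1"
    and Lmono: "\<And>\<alpha> \<beta>. 0 \<le> \<alpha> \<Longrightarrow> \<alpha> \<le> \<beta> \<Longrightarrow> \<beta> \<le> 1 \<Longrightarrow> L \<alpha> \<le> L \<beta>"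
    and Ranti: "\<And>\<alpha> \<beta>. 0 \<le> \<alpha> \<Longrightarrow> \<alpha> \<le> \<beta> \<Longrightarrow> \<beta> \<le> 1 \<Longrightarrow> R \<beta> \<le> R \<alpha>"
    and Lleft: "\<And>\<alpha>. 0 < \<alpha> \<Longrightarrow> \<alpha> \<le> 1 \<Longrightarrow> (L \<longlongrightarrow> L \<alpha>) (at_left \<alpha>)"
    and Rleft: "\<And>\<alpha>. 0 < \<alpha> \<Longrightarrow> \<alpha> \<le> 1 \<Longrightarrow> (R \<longlongrightarrow> R \<alpha>) (at_left \<alpha>)"
    and Lright: "(L \<longlongrightarrow> L 0) (at_right 0)"
    and Rright: "(R \<longlongrightarrow> R 0) (at_right 0)"
  shows "\<exists>!w. \<forall>\<alpha>\<in>{0..1}. lower w \<alpha> = L \<alpha> \<and> upper w \<alpha> = R \<alpha>"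
proof (rule ex_ex1I)
  fix v w
  assume "\<forall>\<alpha>\<in>{0..1}. lower v \<alpha> = L \<alpha> \<and> upper v \<alpha> = R \<alpha>"
    and "\<forall>\<alpha>\<in>{0..1}. lower w \<alpha> = L \<alpha> \<and> upper w \<alpha> = R \<alpha>"
  then show "v = w" by (intro fuzzy_eqI) auto
next
  have LRle: "L \<alpha> \<le> R \<beta>" if "\<alpha> \<in> {0..1}" "\<beta> \<in> {0..1}" for \<alpha> \<beta>
    using Lmono[of \<alpha> 1] LR Ranti[of \<beta> 1] that by auto
  define S where "S t = insert 0 {\<alpha>\<in>{0..1}. L \<alpha> \<le> t \<and> t \<le> R \<alpha>}" for t
  define w where "w t = Sup (S t)" for t
  have S: "S t \<noteq> {}" "bdd_above (S t)" "S t \<subseteq> {0..1}" for t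
    by (auto simp: S_def intro!: bdd_aboveI[of _ 1])
  have w0: "0 \<le> w t" for t
    unfolding w_def by (rule cSup_upper) (use S in \<open>auto simp: S_def\<close>)
  have w1: "w t \<le> 1" for t
    unfolding w_def by (rule cSup_least) (use S(1,3)[of t] in auto)
  have key: "\<alpha> \<le> w t \<longleftrightarrow> t \<in> {L \<alpha>..R \<alpha>}" if a: "0 < \<alpha>" "\<alpha> \<le> 1" for \<alpha> t
  proof
    assume "t \<in> {L \<alpha>..R \<alpha>}"
    then show "\<alpha> \<le> w t"
      unfolding w_def by (intro cSup_upper) (use S a in \<open>auto simp: S_def\<close>)
  next
    assume aw: "\<alpha> \<le> w t"
    have in': "L \<beta> \<le> t \<and> t \<le> R \<beta>" if b: "0 < \<beta>" "\<beta> < \<alpha>" for \<beta>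
    proof -
      have "\<beta> < Sup (S t)" using b aw by (simp add: w_def)
      then obtain \<gamma> where g: "\<gamma> \<in> S t" "\<beta> < \<gamma>" using less_cSup_iff S by metis
      then have "\<gamma> \<in> {0..1}" "L \<gamma> \<le> t" "t \<le> R \<gamma>" using b by (auto simp: S_def)
      then show ?thesis using Lmono[of \<beta> \<gamma>] Ranti[of \<beta> \<gamma>] g b by auto
    qed
    have "\<forall>\<^sub>F \<beta> in at_left \<alpha>. 0 < \<beta> \<and> \<beta> < \<alpha>"
      using a by (auto simp: eventually_at_left[of 0])
    then have ev: "\<forall>\<^sub>F \<beta> in at_left \<alpha>. L \<beta> \<le> t" "\<forall>\<^sub>F \<beta> in at_left \<alpha>. t \<le> R \<beta>"
      by (eventually_elim, use in' in blast)+
    have "L \<alpha> \<le> t" by (rule tendsto_upperbound[OF Lleft[OF a] ev(1)]) simp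
    moreover have "t \<le> R \<alpha>" by (rule tendsto_lowerbound[OF Rleft[OF a] ev(2)]) simp
    ultimately show "t \<in> {L \<alpha>..R \<alpha>}" by simp
  qed
  have supp: "closure {t. w t > 0} = {L 0..R 0}"
  proof (rule antisym)
    have "{t. w t > 0} \<subseteq> {L 0..R 0}"
    proof
      fix t assume "t \<in> {t. w t > 0}"
      then have "t \<in> {L (w t)..R (w t)}" using key[of "w t" t] w1 by simp
      then show "t \<in> {L 0..R 0}"
        using Lmono[of 0 "w t"] Ranti[of 0 "w t"] w0[of t] w1[of t] by simp
    qed
    then show "closure {t. w t > 0} \<subseteq> {L 0..R 0}" by (rule closure_minimal) simp
    show "{L 0..R 0} \<subseteq> closure {t. w t > 0}"
    proof (cases "L 0 < R 0")
      case True
      have "{L 0<..<R 0} \<subseteq> {t. w t > 0}"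
      proof
        fix t assume "t \<in> {L 0<..<R 0}"
        then have "\<forall>\<^sub>F \<beta> in at_right 0. L \<beta> < t" "\<forall>\<^sub>F \<beta> in at_right 0. t < R \<beta>"
          using order_tendstoD[OF Lright] order_tendstoD[OF Rright] by auto
        moreover have "\<forall>\<^sub>F \<beta> in at_right 0. 0 < \<beta> \<and> \<beta> < (1::real)"
          using eventually_at_right_real[of 0 1] by simp
        ultimately have "\<forall>\<^sub>F \<beta> in at_right 0. 0 < \<beta> \<and> \<beta> < 1 \<and> L \<beta> < t \<and> t < R \<beta>"
          by eventually_elim auto
        then obtain \<beta> where "0 < \<beta>" "\<beta> < 1" "L \<beta> < t" "t < R \<beta>"
          using eventually_happens'[OF trivial_limit_at_right_real] by blast
        then show "t \<in> {t. w t > 0}" using key[of \<beta> t] by auto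
      qed
      then have "closure {L 0<..<R 0} \<subseteq> closure {t. w t > 0}" by (rule closure_mono)
      then show ?thesis using True by simp
    next
      case False
      have "w t > 0" if "t \<in> {L 0..R 0}" for t
      proof -
        have "t = L 1" "t \<le> R 1"
          using that False Lmono[of 0 1] Ranti[of 0 1] LR by auto
        then show ?thesis using key[of 1 t] by simp
      qed
      then have "{L 0..R 0} \<subseteq> {t. w t > 0}" by blast
      then show ?thesis using closure_subset by blast
    qed
  qed
  have "w (L 1) = 1" using key[of 1 "L 1"] LR w1[of "L 1"] by auto
  moreover have "fuzzy_convex w"
    unfolding fuzzy_convex_def
  proof (intro allI ballI)
    fix t t' \<theta> :: real assume th: "\<theta> \<in> {0..1}"
    define m where "m = min (w t) (w t')"
    show "min (w t) (w t') \<le> w (\<theta> * t + (1 - \<theta>) * t')"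
    proof (cases "m > 0")
      case True
      have m: "m \<le> 1" "m \<le> w t" "m \<le> w t'" using w1[of t] unfolding m_def by linarith+
      then have "t \<in> {L m..R m}" "t' \<in> {L m..R m}" using key[OF True m(1)] by blast+
      then have "\<theta> *\<^sub>R t + (1 - \<theta>) *\<^sub>R t' \<in> {L m..R m}"
        using th by (intro convexD[OF convex_real_interval(5)]) auto
      then have "m \<le> w (\<theta> * t + (1 - \<theta>) * t')" using key[OF True m(1)] by simp
      then show ?thesis by (simp add: m_def)
    next
      case False
      then show ?thesis using w0[of "\<theta> * t + (1 - \<theta>) * t'"] unfolding m_def by linarith
    qed
  qed
  moreover have "upper_semicontinuous w"
    unfolding upper_semicontinuous_def
  proof (intro allI impI)
    fix t e :: real assume e: "e > 0"
    show "\<forall>\<^sub>F y in nhds t. w y < w t + e"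
    proof (cases "w t + e \<le> 1")
      case True
      have a: "0 < w t + e" using w0[of t] e by simp
      have "\<not> w t + e \<le> w t" using e by simp
      then have "t \<in> - {L (w t + e)..R (w t + e)}" unfolding key[OF a True] by simp
      then have "\<forall>\<^sub>F y in nhds t. y \<in> - {L (w t + e)..R (w t + e)}"
        by (intro eventually_nhds_in_open) auto
      then show ?thesis
      proof eventually_elim
        case (elim y)
        then have "\<not> w t + e \<le> w y" unfolding key[OF a True] by simp
        then show ?case by simp
      qed
    next
      case False
      then have "w y < w t + e" for y using w1[of y] by simp
      then show ?thesis by simp
    qed
  qed
  moreover have "w t \<in> {0..1}" for t using w0 w1 by simp
  moreover have "compact (closure {t. w t > 0})" by (simp add: supp)
  ultimately have "is_fuzzy_number w" unfolding is_fuzzy_number_def by blast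
  then have mem: "membership (Abs_fuzzy w) = w" by (simp add: Abs_fuzzy_inverse)
  have lev: "level (Abs_fuzzy w) \<alpha> = {L \<alpha>..R \<alpha>}" if "\<alpha> \<in> {0..1}" for \<alpha>
  proof (cases "\<alpha> = 0")
    case True
    then show ?thesis by (simp add: level_def mem supp)
  next
    case False
    then have "0 < \<alpha>" "\<alpha> \<le> 1" using that by auto
    from key[OF this] show ?thesis using False by (simp add: level_def mem set_eq_iff)
  qed
  have "\<forall>\<alpha>\<in>{0..1}. lower (Abs_fuzzy w) \<alpha> = L \<alpha> \<and> upper (Abs_fuzzy w) \<alpha> = R \<alpha>"
    using LRle by (simp add: lower_def upper_def lev)
  then show "\<exists>w. \<forall>\<alpha>\<in>{0..1}. lower w \<alpha> = L \<alpha> \<and> upper w \<alpha> = R \<alpha>" by blast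
qed

section \<open>The metric\<close>

instantiation fuzzy :: metric_space
begin

definition dist_fuzzy :: "fuzzy \<Rightarrow> fuzzy \<Rightarrow> real" where
  "dist_fuzzy u v =
     (SUP \<alpha>\<in>{0..1}. max \<bar>lower u \<alpha> - lower v \<alpha>\<bar> \<bar>upper u \<alpha> - upper v \<alpha>\<bar>)"

definition uniformity_fuzzy :: "(fuzzy \<times> fuzzy) filter" where
  "uniformity_fuzzy = (INF e\<in>{0 <..}. principal {(u, v). dist u v < e})"

definition open_fuzzy :: "fuzzy set \<Rightarrow> bool" where
  "open_fuzzy U = (\<forall>u\<in>U. \<forall>\<^sub>F (u', v) in uniformity. u' = u \<longrightarrow> v \<in> U)"

lemma dist_fuzzy_bdd:
  "bdd_above ((\<lambda>\<alpha>. max \<bar>lower u \<alpha> - lower v \<alpha>\<bar> \<bar>upper u \<alpha> - upper v \<alpha>\<bar>) ` {0..1})"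
proof (rule bdd_aboveI2)
  fix \<alpha> :: real assume "\<alpha> \<in> {0..1}"
  then show "max \<bar>lower u \<alpha> - lower v \<alpha>\<bar> \<bar>upper u \<alpha> - upper v \<alpha>\<bar>
      \<le> \<bar>lower u 0\<bar> + \<bar>upper u 0\<bar> + \<bar>lower v 0\<bar> + \<bar>upper v 0\<bar>"
    using lower_mono[of 0 \<alpha> u] lower_mono[of 0 \<alpha> v] upper_anti[of 0 \<alpha> u] upper_anti[of 0 \<alpha> v]
      level_eq_interval(2)[of \<alpha> u] level_eq_interval(2)[of \<alpha> v]
    by auto
qed

lemma dist_fuzzy_ge:
  assumes "\<alpha> \<in> {0..1}"
  shows "\<bar>lower u \<alpha> - lower v \<alpha>\<bar> \<le> dist u v" and "\<bar>upper u \<alpha> - upper v \<alpha>\<bar> \<le> dist u v"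
  using cSUP_upper[OF assms dist_fuzzy_bdd[of u v]] by (auto simp: dist_fuzzy_def)

lemma dist_fuzzy_le:
  assumes "\<And>\<alpha>. \<alpha> \<in> {0..1} \<Longrightarrow> \<bar>lower u \<alpha> - lower v \<alpha>\<bar> \<le> d"
    and "\<And>\<alpha>. \<alpha> \<in> {0..1} \<Longrightarrow> \<bar>upper u \<alpha> - upper v \<alpha>\<bar> \<le> d"
  shows "dist u v \<le> d"
  unfolding dist_fuzzy_def by (rule cSUP_least) (use assms in auto)

instance
proof
  fix u v w :: fuzzy
  show "dist u v = 0 \<longleftrightarrow> u = v"
  proof
    assume d: "dist u v = 0"
    show "u = v"
      by (rule fuzzy_eqI) (use dist_fuzzy_ge[of _ u v] d in fastforce)+
  qed (simp add: dist_fuzzy_def)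
  show "dist u v \<le> dist u w + dist v w"
  proof (rule dist_fuzzy_le)
    fix \<alpha> :: real assume a: "\<alpha> \<in> {0..1}"
    show "\<bar>lower u \<alpha> - lower v \<alpha>\<bar> \<le> dist u w + dist v w"
      using dist_fuzzy_ge(1)[OF a, of u w] dist_fuzzy_ge(1)[OF a, of v w] by linarith
    show "\<bar>upper u \<alpha> - upper v \<alpha>\<bar> \<le> dist u w + dist v w"
      using dist_fuzzy_ge(2)[OF a, of u w] dist_fuzzy_ge(2)[OF a, of v w] by linarith
  qed
qed (simp_all add: uniformity_fuzzy_def open_fuzzy_def)

end

section \<open>Levelwise operations\<close>

instantiation fuzzy :: comm_monoid_add
begin

definition zero_fuzzy :: fuzzy where
  "0 = Abs_fuzzy (indicator {0})"

definition plus_fuzzy :: "fuzzy \<Rightarrow> fuzzy \<Rightarrow> fuzzy" where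
  "u + v = (THE w. \<forall>\<alpha>\<in>{0..1}.
     lower w \<alpha> = lower u \<alpha> + lower v \<alpha> \<and> upper w \<alpha> = upper u \<alpha> + upper v \<alpha>)"

lemma endpoints_zero:
  assumes "\<alpha> \<in> {0..1}"
  shows "lower 0 \<alpha> = 0" and "upper 0 \<alpha> = 0"
proof -
  have "{t. \<alpha> \<le> indicator {0} t} = {0::real}" if "\<alpha> \<noteq> 0"
    using that assms by (auto simp: indicator_def split: if_splits)
  moreover have "{t. 0 < (indicator {0} t :: real)} = {0::real}"
    by (auto simp: indicator_def)
  ultimately have "level 0 \<alpha> = {0}"
    by (simp add: level_def zero_fuzzy_def Abs_fuzzy_inverse is_fuzzy_number_indicator)
  then show "lower 0 \<alpha> = 0" "upper 0 \<alpha> = 0" by (simp_all add: lower_def upper_def)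
qed

lemma endpoints_plus:
  assumes "\<alpha> \<in> {0..1}"
  shows "lower (u + v) \<alpha> = lower u \<alpha> + lower v \<alpha>"
    and "upper (u + v) \<alpha> = upper u \<alpha> + upper v \<alpha>"
proof -
  have "\<exists>!w. \<forall>\<alpha>\<in>{0..1}.
      lower w \<alpha> = lower u \<alpha> + lower v \<alpha> \<and> upper w \<alpha> = upper u \<alpha> + upper v \<alpha>"
    by (rule fuzzy_from_endpoints)
      (auto intro!: add_mono tendsto_add lower_mono upper_anti level_eq_interval(2)
        endpoints_left_continuous endpoints_right_continuous)
  from theI'[OF this] assms
  show "lower (u + v) \<alpha> = lower u \<alpha> + lower v \<alpha>" "upper (u + v) \<alpha> = upper u \<alpha> + upper v \<alpha>"
    unfolding plus_fuzzy_def by auto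
qed

instance
  by standard (rule fuzzy_eqI; simp add: endpoints_plus endpoints_zero)+

end

instantiation fuzzy :: scaleR
begin

definition scaleR_fuzzy :: "real \<Rightarrow> fuzzy \<Rightarrow> fuzzy" where
  "k *\<^sub>R u = (THE w. \<forall>\<alpha>\<in>{0..1}.
     lower w \<alpha> = (if k \<ge> 0 then k * lower u \<alpha> else k * upper u \<alpha>) \<and>
     upper w \<alpha> = (if k \<ge> 0 then k * upper u \<alpha> else k * lower u \<alpha>))"

instance ..

end

lemma endpoints_scaleR:
  fixes u :: fuzzy
  assumes "\<alpha> \<in> {0..1}"
  shows "lower (k *\<^sub>R u) \<alpha> = (if k \<ge> 0 then k * lower u \<alpha> else k * upper u \<alpha>)"
    and "upper (k *\<^sub>R u) \<alpha> = (if k \<ge> 0 then k * upper u \<alpha> else k * lower u \<alpha>)"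
proof -
  have "\<exists>!w. \<forall>\<alpha>\<in>{0..1}.
     lower w \<alpha> = (if k \<ge> 0 then k * lower u \<alpha> else k * upper u \<alpha>) \<and>
     upper w \<alpha> = (if k \<ge> 0 then k * upper u \<alpha> else k * lower u \<alpha>)"
  proof (cases "k \<ge> 0")
    case True
    have "\<exists>!w. \<forall>\<alpha>\<in>{0..1}. lower w \<alpha> = k * lower u \<alpha> \<and> upper w \<alpha> = k * upper u \<alpha>"
    proof (rule fuzzy_from_endpoints)
      show "k * lower u 1 \<le> k * upper u 1"
        using True by (intro mult_left_mono level_eq_interval(2)) auto
      show "k * lower u \<alpha> \<le> k * lower u \<beta>" "k * upper u \<beta> \<le> k * upper u \<alpha>"
        if "0 \<le> \<alpha>" "\<alpha> \<le> \<beta>" "\<beta> \<le> 1" for \<alpha> \<beta>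
        using True lower_mono[OF that, of u] upper_anti[OF that, of u]
        by (simp_all add: mult_left_mono)
    qed (intro tendsto_mult_left endpoints_left_continuous endpoints_right_continuous; assumption)+
    then show ?thesis using True by (simp only: if_True)
  next
    case False
    have "\<exists>!w. \<forall>\<alpha>\<in>{0..1}. lower w \<alpha> = k * upper u \<alpha> \<and> upper w \<alpha> = k * lower u \<alpha>"
    proof (rule fuzzy_from_endpoints)
      show "k * upper u 1 \<le> k * lower u 1"
        using False by (intro mult_left_mono_neg level_eq_interval(2)) auto
      show "k * upper u \<alpha> \<le> k * upper u \<beta>" "k * lower u \<beta> \<le> k * lower u \<alpha>"
        if "0 \<le> \<alpha>" "\<alpha> \<le> \<beta>" "\<beta> \<le> 1" for \<alpha> \<beta>
        using False lower_mono[OF that, of u] upper_anti[OF that, of u]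
        by (simp_all add: mult_left_mono_neg)
    qed (intro tendsto_mult_left endpoints_left_continuous endpoints_right_continuous; assumption)+
    then show ?thesis using False by (simp only: if_False)
  qed
  note w = bspec[OF theI'[OF this] assms, folded scaleR_fuzzy_def]
  show "lower (k *\<^sub>R u) \<alpha> = (if k \<ge> 0 then k * lower u \<alpha> else k * upper u \<alpha>)"
    by (rule conjunct1[OF w])
  show "upper (k *\<^sub>R u) \<alpha> = (if k \<ge> 0 then k * upper u \<alpha> else k * lower u \<alpha>)"
    by (rule conjunct2[OF w])
qed

section \<open>The fuzzy Riemann integral\<close>

definition has_fuzzy_integral :: "(real \<Rightarrow> fuzzy) \<Rightarrow> fuzzy \<Rightarrow> real \<Rightarrow> real \<Rightarrow> bool" where
  "has_fuzzy_integral g I a b \<longleftrightarrow>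
     (\<forall>\<epsilon>>0. \<exists>\<delta>>0. \<forall>(n::nat) (t::nat \<Rightarrow> real) (\<xi>::nat \<Rightarrow> real).
        t 0 = a \<and> t n = b \<and>
        (\<forall>i\<in>{1..n}. t (i - 1) < t i \<and> \<xi> i \<in> {t (i - 1)..t i} \<and> t i - t (i - 1) < \<delta>) \<longrightarrow>
        dist (\<Sum>i=1..n. (t i - t (i - 1)) *\<^sub>R g (\<xi> i)) I < \<epsilon>)"

definition fuzzy_integrable :: "(real \<Rightarrow> fuzzy) \<Rightarrow> real \<Rightarrow> real \<Rightarrow> bool" where
  "fuzzy_integrable g a b \<longleftrightarrow> (\<exists>I. has_fuzzy_integral g I a b)"

definition fuzzy_integral :: "(real \<Rightarrow> fuzzy) \<Rightarrow> real \<Rightarrow> real \<Rightarrow> fuzzy" where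
  "fuzzy_integral g a b = (THE I. has_fuzzy_integral g I a b)"

section \<open>Level Fourier series\<close>

text \<open>In the following definitions \<open>e\<close> is one of the endpoint functions \<open>lower\<close> (sign \<open>-\<close>)
  and \<open>upper\<close> (sign \<open>+\<close>).\<close>

definition fourier_a :: "(fuzzy \<Rightarrow> real \<Rightarrow> real) \<Rightarrow> (real \<Rightarrow> fuzzy) \<Rightarrow> nat \<Rightarrow> real \<Rightarrow> real" where
  "fourier_a e f n \<alpha> = 1 / pi * integral {-pi..pi} (\<lambda>x. e (f x) \<alpha> * cos (real n * x))"

definition fourier_b :: "(fuzzy \<Rightarrow> real \<Rightarrow> real) \<Rightarrow> (real \<Rightarrow> fuzzy) \<Rightarrow> nat \<Rightarrow> real \<Rightarrow> real" where
  "fourier_b e f n \<alpha> = 1 / pi * integral {-pi..pi} (\<lambda>x. e (f x) \<alpha> * sin (real n * x))"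

definition fourier_term ::
  "(fuzzy \<Rightarrow> real \<Rightarrow> real) \<Rightarrow> (real \<Rightarrow> fuzzy) \<Rightarrow> nat \<Rightarrow> real \<Rightarrow> real \<Rightarrow> real" where
  "fourier_term e f n \<alpha> x =
     (if n = 0 then fourier_a e f 0 \<alpha> / 2
      else fourier_a e f n \<alpha> * cos (real n * x) + fourier_b e f n \<alpha> * sin (real n * x))"

definition abel_poisson_integral :: "(real \<Rightarrow> fuzzy) \<Rightarrow> real \<Rightarrow> real \<Rightarrow> fuzzy" where
  "abel_poisson_integral f s x =
     ((1 - exp (-2 * s)) / (2 * pi)) *\<^sub>R
       fuzzy_integral (\<lambda>t. (1 / (1 - 2 * exp (-s) * cos t + exp (-2 * s))) *\<^sub>R f (x - t)) (-pi) pi"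

end

theory Submission
  imports Defs
begin

text \<open>
  A fuzzy Riemann sum has as endpoints the Riemann sums of the endpoint functions. For a continuous
  integrand these converge uniformly in the level \<open>\<alpha>\<close>, so the integrals of the endpoint
  functions inherit the one-sided continuity in \<open>\<alpha>\<close> that makes them the endpoints of a fuzzy
  number. The Abel means of the level Fourier series are convolutions with the Poisson kernel at
  \<open>r = e\<^sup>-\<^sup>s\<close>, and since this kernel is nonnegative with mass \<open>2 \<pi>\<close>, the distance of the convolution
  from \<open>f x\<close> is at most the Poisson mean of the real function \<open>t \<mapsto> D (f (x - t)) (f x)\<close>, which
  vanishes at \<open>0\<close>; uniformity in \<open>\<alpha>\<close> is thus automatic.
\<close>

section \<open>Integrals of continuous fuzzy valued functions\<close>

text \<open>Isolates the premise on tagged partitions in \<open>has_fuzzy_integral_def\<close>.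
  Values of \<open>t\<close> and \<open>\<xi>\<close> beyond index \<open>n\<close> are
  unconstrained, so an induction on \<open>n\<close> can drop the last interval without changing
  either function.\<close>

definition fine_partition ::
    "real \<Rightarrow> real \<Rightarrow> real \<Rightarrow> nat \<Rightarrow> (nat \<Rightarrow> real) \<Rightarrow> (nat \<Rightarrow> real) \<Rightarrow> bool" where
  "fine_partition a b \<delta> n t \<xi> \<longleftrightarrow> t 0 = a \<and> t n = b \<and>
     (\<forall>i\<in>{1..n}. t (i - 1) < t i \<and> \<xi> i \<in> {t (i - 1)..t i} \<and> t i - t (i - 1) < \<delta>)"

lemma has_fuzzy_integral_iff:
  "has_fuzzy_integral g I a b \<longleftrightarrow> (\<forall>\<epsilon>>0. \<exists>\<delta>>0. \<forall>n t \<xi>. fine_partition a b \<delta> n t \<xi> \<longrightarrow>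
     dist (\<Sum>i=1..n. (t i - t (i - 1)) *\<^sub>R g (\<xi> i)) I < \<epsilon>)"
  unfolding has_fuzzy_integral_def fine_partition_def ..

text \<open>Equidistant points, each interval tagged by its right end. Without such partitions the
  integral condition would hold vacuously for every candidate.\<close>

lemma fine_partition_exists:
  fixes a b \<delta> :: real
  assumes "a < b" "\<delta> > 0"
  shows "\<exists>n t \<xi>. fine_partition a b \<delta> n t \<xi>"
proof -
  obtain n where n: "real n > (b - a) / \<delta>" using reals_Archimedean2 by blast
  moreover have "(b - a) / \<delta> > 0" using assms by simp
  ultimately have n0: "real n > 0" by linarith
  define t where "t i = a + real i * ((b - a) / n)" for i
  have step: "t i - t (i - 1) = (b - a) / n" if "i \<in> {1..n}" for i
  proof -
    have "real (i - 1) = real i - 1" using that by auto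
    then show ?thesis by (simp add: t_def left_diff_distrib diff_divide_distrib)
  qed
  have pos: "(b - a) / n > 0" using assms n0 by simp
  have small: "(b - a) / n < \<delta>" using n n0 assms by (simp add: field_simps)
  have "t (i - 1) < t i \<and> t i \<in> {t (i - 1)..t i} \<and> t i - t (i - 1) < \<delta>" if "i \<in> {1..n}" for i
    using step[OF that] pos small by auto
  moreover have "t 0 = a" "t n = b" using n0 by (simp_all add: t_def)
  ultimately show ?thesis unfolding fine_partition_def by blast
qed

text \<open>Each interval contributes an error of at most \<open>\<epsilon>\<close> times its
  length, and the lengths add up to \<open>b - a\<close>. The induction splits off the last
  interval, with \<open>b\<close> generalised; \<open>a \<le> b\<close> is carried along because
  splitting the integral at \<open>t n\<close> needs \<open>a \<le> t n\<close>.\<close>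

lemma riemann_sum_error:
  fixes \<phi> :: "real \<Rightarrow> real"
  assumes "fine_partition a b \<delta> n t \<xi>"
    and "continuous_on {a..b} \<phi>"
    and "\<And>x y. x \<in> {a..b} \<Longrightarrow> y \<in> {a..b} \<Longrightarrow> \<bar>x - y\<bar> < \<delta> \<Longrightarrow> \<bar>\<phi> x - \<phi> y\<bar> \<le> \<epsilon>"
  shows "a \<le> b \<and> \<bar>(\<Sum>i=1..n. (t i - t (i - 1)) * \<phi> (\<xi> i)) - integral {a..b} \<phi>\<bar> \<le> \<epsilon> * (b - a)"
  using assms
proof (induction n arbitrary: b)
  case 0
  then show ?case by (auto simp: fine_partition_def)
next
  case (Suc n)
  define c where "c = t n"
  have last: "c < b" "c \<le> \<xi> (Suc n)" "\<xi> (Suc n) \<le> b" "b - c < \<delta>" "t (Suc n) = b"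
    using Suc.prems(1) unfolding c_def fine_partition_def by (auto dest!: bspec[where x = "Suc n"])
  have IH: "a \<le> c \<and> \<bar>(\<Sum>i=1..n. (t i - t (i - 1)) * \<phi> (\<xi> i)) - integral {a..c} \<phi>\<bar> \<le> \<epsilon> * (c - a)"
  proof (rule Suc.IH)
    show "fine_partition a c \<delta> n t \<xi>" using Suc.prems(1) by (auto simp: c_def fine_partition_def)
    show "continuous_on {a..c} \<phi>"
      by (rule continuous_on_subset[OF Suc.prems(2)]) (use last in auto)
    show "\<bar>\<phi> x - \<phi> y\<bar> \<le> \<epsilon>" if "x \<in> {a..c}" "y \<in> {a..c}" "\<bar>x - y\<bar> < \<delta>" for x y
      using Suc.prems(3)[of x y] that last by auto
  qed
  have int: "\<phi> integrable_on {a..b}"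
    using Suc.prems(2) by (rule integrable_continuous_interval)
  have intc: "\<phi> integrable_on {c..b}"
    by (rule integrable_subinterval_real[OF int]) (use IH in auto)
  have split: "integral {a..b} \<phi> = integral {a..c} \<phi> + integral {c..b} \<phi>"
    using Henstock_Kurzweil_Integration.integral_combine[OF _ _ int, of c] IH last by simp
  have const: "integral {c..b} (\<lambda>_. k) = (b - c) * k" for k :: real
    using last(1) by (simp add: integral_const_real)
  \<comment> \<open>The last tag and \<open>x\<close> both lie in an interval shorter than
    \<open>\<delta>\<close>.\<close>
  have *: "\<phi> (\<xi> (Suc n)) - \<epsilon> \<le> \<phi> x \<and> \<phi> x \<le> \<phi> (\<xi> (Suc n)) + \<epsilon>" if "x \<in> {c..b}" for x
  proof -
    have "\<bar>\<phi> (\<xi> (Suc n)) - \<phi> x\<bar> \<le> \<epsilon>"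
      by (rule Suc.prems(3)) (use that last IH in auto)
    then show ?thesis by linarith
  qed
  have "(b - c) * (\<phi> (\<xi> (Suc n)) - \<epsilon>) \<le> integral {c..b} \<phi>"
    unfolding const[symmetric] by (rule integral_le) (use intc * in auto)
  moreover have "integral {c..b} \<phi> \<le> (b - c) * (\<phi> (\<xi> (Suc n)) + \<epsilon>)"
    unfolding const[symmetric] by (rule integral_le) (use intc * in auto)
  ultimately have "\<bar>(b - c) * \<phi> (\<xi> (Suc n)) - integral {c..b} \<phi>\<bar> \<le> \<epsilon> * (b - c)"
    by (simp add: algebra_simps abs_le_iff)
  moreover have "\<epsilon> * (b - a) = \<epsilon> * (c - a) + \<epsilon> * (b - c)"
    by (simp add: algebra_simps)
  ultimately show ?case
    using IH last split by (simp add: c_def[symmetric]) linarith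
qed

section \<open>The two endpoint functions, treated uniformly\<close>

text \<open>Lets one proof serve both signs.\<close>

definition is_endpoint :: "(fuzzy \<Rightarrow> real \<Rightarrow> real) \<Rightarrow> bool" where
  "is_endpoint e \<longleftrightarrow> e = lower \<or> e = upper"

lemma is_endpoint_simps [simp]: "is_endpoint lower" "is_endpoint upper"
  by (simp_all add: is_endpoint_def)

context
  fixes e :: "fuzzy \<Rightarrow> real \<Rightarrow> real" and \<alpha> :: real
  assumes e: "is_endpoint e" and \<alpha>: "\<alpha> \<in> {0..1}"
begin

text \<open>The metric is a supremum over levels, so the Lipschitz constant 1 serves all of them;
  the later uniformity in \<open>\<alpha>\<close> comes from here.\<close>

lemma endpoint_lipschitz: "\<bar>e u \<alpha> - e v \<alpha>\<bar> \<le> dist u v"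
  using e dist_fuzzy_ge[OF \<alpha>] by (auto simp: is_endpoint_def)

lemma endpoint_zero: "e 0 \<alpha> = 0"
  using e endpoints_zero[OF \<alpha>] by (auto simp: is_endpoint_def)

text \<open>A negative factor would exchange the endpoints. The factors met below are interval
  lengths and parts of the Poisson kernel, all nonnegative.\<close>

lemma endpoint_scaleR: "0 \<le> k \<Longrightarrow> e (k *\<^sub>R u) \<alpha> = k * e u \<alpha>"
  using e endpoints_scaleR[OF \<alpha>] by (auto simp: is_endpoint_def)

lemma endpoint_sum: "e (sum h A) \<alpha> = (\<Sum>i\<in>A. e (h i) \<alpha>)"
  using e endpoints_plus[OF \<alpha>]
  by (induction A rule: infinite_finite_induct) (auto simp: is_endpoint_def endpoints_zero[OF \<alpha>])

lemma endpoint_riemann_sum: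
  assumes "fine_partition a b \<delta> n t \<xi>"
  shows "e (\<Sum>i=1..n. (t i - t (i - 1)) *\<^sub>R g (\<xi> i)) \<alpha>
    = (\<Sum>i=1..n. (t i - t (i - 1)) * e (g (\<xi> i)) \<alpha>)"
  unfolding endpoint_sum
proof (rule sum.cong)
  fix i assume "i \<in> {1..n}"
  with assms have "0 \<le> t i - t (i - 1)" by (force simp: fine_partition_def)
  then show "e ((t i - t (i - 1)) *\<^sub>R g (\<xi> i)) \<alpha> = (t i - t (i - 1)) * e (g (\<xi> i)) \<alpha>"
    by (rule endpoint_scaleR)
qed simp

lemma endpoint_continuous_on:
  assumes "continuous_on S g"
  shows "continuous_on S (\<lambda>x. e (g x) \<alpha>)"
proof (rule continuous_on_compose2[OF _ assms])
  show "continuous_on UNIV (\<lambda>u. e u \<alpha>)"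
    unfolding continuous_on_iff
  proof (intro ballI allI impI)
    fix u and \<epsilon> :: real assume "\<epsilon> > 0"
    moreover have "dist (e v \<alpha>) (e u \<alpha>) \<le> dist v u" for v
      using endpoint_lipschitz by (simp add: dist_real_def)
    ultimately show "\<exists>d>0. \<forall>v\<in>UNIV. dist v u < d \<longrightarrow> dist (e v \<alpha>) (e u \<alpha>) < \<epsilon>"
      by (meson le_less_trans)
  qed
qed simp

end

lemma endpoint_left_continuous:
  assumes "is_endpoint e" "0 < \<alpha>" "\<alpha> \<le> 1"
  shows "(e u \<longlongrightarrow> e u \<alpha>) (at_left \<alpha>)"
  using assms endpoints_left_continuous[OF assms(2,3)] by (auto simp: is_endpoint_def)

lemma endpoint_right_continuous:
  assumes "is_endpoint e"
  shows "(e u \<longlongrightarrow> e u 0) (at_right 0)"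
  using assms endpoints_right_continuous by (auto simp: is_endpoint_def)

section \<open>Uniqueness, existence and endpoints of the fuzzy Riemann integral\<close>

text \<open>A Riemann sum over a partition fine enough for both integrals would lie within half of
  \<open>dist I J\<close> of each.\<close>

lemma has_fuzzy_integral_unique:
  assumes "has_fuzzy_integral g I a b" "has_fuzzy_integral g J a b" "a < b"
  shows "I = J"
proof (rule ccontr)
  assume "I \<noteq> J"
  then have pos: "dist I J / 2 > 0" by simp
  obtain \<delta>1 where 1: "\<delta>1 > 0" "\<forall>n t \<xi>. fine_partition a b \<delta>1 n t \<xi> \<longrightarrow>
      dist (\<Sum>i=1..n. (t i - t (i - 1)) *\<^sub>R g (\<xi> i)) I < dist I J / 2"
    using assms(1) pos unfolding has_fuzzy_integral_iff by blast
  obtain \<delta>2 where 2: "\<delta>2 > 0" "\<forall>n t \<xi>. fine_partition a b \<delta>2 n t \<xi> \<longrightarrow>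
      dist (\<Sum>i=1..n. (t i - t (i - 1)) *\<^sub>R g (\<xi> i)) J < dist I J / 2"
    using assms(2) pos unfolding has_fuzzy_integral_iff by blast
  obtain n t \<xi> where p: "fine_partition a b (min \<delta>1 \<delta>2) n t \<xi>"
    using fine_partition_exists[OF assms(3), of "min \<delta>1 \<delta>2"] 1(1) 2(1) by auto
  then have "fine_partition a b \<delta>1 n t \<xi>" "fine_partition a b \<delta>2 n t \<xi>"
    by (auto simp: fine_partition_def)
  from dist_triangle_half_r[OF 1(2)[rule_format, OF this(1)] 2(2)[rule_format, OF this(2)]]
  have "dist I J < dist I J" .
  then show False by simp
qed

text \<open>Uniform continuity of \<open>g\<close> in the fuzzy metric yields a single
  \<open>\<delta>\<close> for which every endpoint function oscillates by at most
  \<open>\<epsilon> / (b - a)\<close>, whatever the level and the sign.\<close>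

lemma riemann_sum_endpoints_uniform:
  assumes "a < b" "continuous_on {a..b} g" "\<epsilon> > 0"
  shows "\<exists>\<delta>>0. \<forall>n t \<xi>. fine_partition a b \<delta> n t \<xi> \<longrightarrow>
    (\<forall>e \<alpha>. is_endpoint e \<longrightarrow> \<alpha> \<in> {0..1} \<longrightarrow>
      \<bar>e (\<Sum>i=1..n. (t i - t (i - 1)) *\<^sub>R g (\<xi> i)) \<alpha> - integral {a..b} (\<lambda>x. e (g x) \<alpha>)\<bar> \<le> \<epsilon>)"
proof -
  have "uniformly_continuous_on {a..b} g"
    using assms(2) by (rule compact_uniformly_continuous) simp
  moreover have "\<epsilon> / (b - a) > 0" using assms by simp
  ultimately obtain \<delta> where \<delta>: "\<delta> > 0"
    "\<And>x y. x \<in> {a..b} \<Longrightarrow> y \<in> {a..b} \<Longrightarrow> dist y x < \<delta> \<Longrightarrow> dist (g y) (g x) < \<epsilon> / (b - a)"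
    unfolding uniformly_continuous_on_def by meson
  show ?thesis
  proof (intro exI[of _ \<delta>] conjI \<delta>(1) allI impI)
    fix n t \<xi> e and \<alpha> :: real
    assume p: "fine_partition a b \<delta> n t \<xi>" and e: "is_endpoint e" "\<alpha> \<in> {0..1}"
    have osc: "\<bar>e (g x) \<alpha> - e (g y) \<alpha>\<bar> \<le> \<epsilon> / (b - a)"
      if "x \<in> {a..b}" "y \<in> {a..b}" "\<bar>x - y\<bar> < \<delta>" for x y
      using endpoint_lipschitz[OF e, of "g x" "g y"] \<delta>(2)[OF that(2,1)] that(3)
      by (simp add: dist_real_def)
    have "\<epsilon> / (b - a) * (b - a) = \<epsilon>" using assms(1) by simp
    with riemann_sum_error[OF p endpoint_continuous_on[OF e assms(2)] osc]
    show "\<bar>e (\<Sum>i=1..n. (t i - t (i - 1)) *\<^sub>R g (\<xi> i)) \<alpha> - integral {a..b} (\<lambda>x. e (g x) \<alpha>)\<bar> \<le> \<epsilon>"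
      unfolding endpoint_riemann_sum[OF e p] by metis
  qed
qed

theorem has_fuzzy_integral_continuous:
  assumes ab: "a < b" and g: "continuous_on {a..b} g"
  shows "\<exists>I. has_fuzzy_integral g I a b \<and>
    (\<forall>e \<alpha>. is_endpoint e \<longrightarrow> \<alpha> \<in> {0..1} \<longrightarrow> e I \<alpha> = integral {a..b} (\<lambda>x. e (g x) \<alpha>))"
proof -
  define L where "L e \<alpha> = integral {a..b} (\<lambda>x. e (g x) \<alpha>)" for e :: "fuzzy \<Rightarrow> real \<Rightarrow> real" and \<alpha>
  have int: "(\<lambda>x. e (g x) \<alpha>) integrable_on {a..b}" if "is_endpoint e" "\<alpha> \<in> {0..1}" for e \<alpha>
    by (intro integrable_continuous_interval endpoint_continuous_on that g)
  \<comment> \<open>The witness is a Riemann sum: as a fuzzy number it already has endpoints with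
    the required one-sided continuity.\<close>
  have approx: "\<exists>u. \<forall>\<alpha>\<in>{0..1}. \<bar>e u \<alpha> - L e \<alpha>\<bar> \<le> \<epsilon>" if e: "is_endpoint e" and "\<epsilon> > 0" for e \<epsilon>
  proof -
    obtain \<delta> where "\<delta> > 0" and
      \<delta>: "\<forall>n t \<xi>. fine_partition a b \<delta> n t \<xi> \<longrightarrow>
        (\<forall>e \<alpha>. is_endpoint e \<longrightarrow> \<alpha> \<in> {0..1} \<longrightarrow>
          \<bar>e (\<Sum>i=1..n. (t i - t (i - 1)) *\<^sub>R g (\<xi> i)) \<alpha> - L e \<alpha>\<bar> \<le> \<epsilon>)"
      using riemann_sum_endpoints_uniform[OF ab g \<open>\<epsilon> > 0\<close>] unfolding L_def by blast
    obtain n t \<xi> where "fine_partition a b \<delta> n t \<xi>"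
      using fine_partition_exists[OF ab \<open>\<delta> > 0\<close>] by blast
    with \<delta> e show ?thesis by blast
  qed
  \<comment> \<open>A uniform limit inherits continuity, by splitting into thirds. The filter stands
    for \<open>at_left \<alpha>\<close> and for \<open>at_right 0\<close>; \<open>ev\<close> keeps
    the levels where the approximation is valid.\<close>
  have lim: "(L e \<longlongrightarrow> L e \<alpha>) F"
    if e: "is_endpoint e" and \<alpha>: "\<alpha> \<in> {0..1}" and F: "\<And>u. (e u \<longlongrightarrow> e u \<alpha>) F"
      and ev: "\<forall>\<^sub>F \<beta> in F. \<beta> \<in> {0..1}" for e \<alpha> F
  proof (rule tendstoI)
    fix \<epsilon> :: real assume "\<epsilon> > 0"
    then have "\<epsilon> / 3 > 0" by simp
    then obtain u where u: "\<And>\<beta>. \<beta> \<in> {0..1} \<Longrightarrow> \<bar>e u \<beta> - L e \<beta>\<bar> \<le> \<epsilon> / 3"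
      using approx[OF e] by blast
    have "\<forall>\<^sub>F \<beta> in F. dist (e u \<beta>) (e u \<alpha>) < \<epsilon> / 3"
      using F[of u] \<open>\<epsilon> > 0\<close> by (intro tendstoD) auto
    with ev show "\<forall>\<^sub>F \<beta> in F. dist (L e \<beta>) (L e \<alpha>) < \<epsilon>"
    proof eventually_elim
      case (elim \<beta>)
      then show ?case using u[of \<beta>] u[OF \<alpha>] unfolding dist_real_def by linarith
    qed
  qed
  have left: "(L e \<longlongrightarrow> L e \<alpha>) (at_left \<alpha>)" if "is_endpoint e" "0 < \<alpha>" "\<alpha> \<le> 1" for e \<alpha>
  proof (rule lim)
    show "\<forall>\<^sub>F \<beta> in at_left \<alpha>. \<beta> \<in> {0..1}"
      using that by (auto simp: eventually_at_left[of 0] intro!: exI[of _ 0])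
  qed (use that endpoint_left_continuous in auto)
  have right: "(L e \<longlongrightarrow> L e 0) (at_right 0)" if "is_endpoint e" for e
  proof (rule lim)
    show "\<forall>\<^sub>F \<beta> in at_right 0. \<beta> \<in> {0..1::real}"
      by (auto simp: eventually_at_right[of 0 1] intro!: exI[of _ 1])
  qed (use that endpoint_right_continuous in auto)
  have "\<exists>!w. \<forall>\<alpha>\<in>{0..1}. lower w \<alpha> = L lower \<alpha> \<and> upper w \<alpha> = L upper \<alpha>"
  proof (rule fuzzy_from_endpoints)
    show "L lower 1 \<le> L upper 1" unfolding L_def
      by (rule integral_le) (auto intro: int level_eq_interval(2))
    show "L lower \<alpha> \<le> L lower \<beta>" if "0 \<le> \<alpha>" "\<alpha> \<le> \<beta>" "\<beta> \<le> 1" for \<alpha> \<beta>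
      unfolding L_def by (rule integral_le) (use that in \<open>auto intro: int lower_mono\<close>)
    show "L upper \<beta> \<le> L upper \<alpha>" if "0 \<le> \<alpha>" "\<alpha> \<le> \<beta>" "\<beta> \<le> 1" for \<alpha> \<beta>
      unfolding L_def by (rule integral_le) (use that in \<open>auto intro: int upper_anti\<close>)
  qed (simp_all add: left right)
  then obtain I where "\<forall>\<alpha>\<in>{0..1}. lower I \<alpha> = L lower \<alpha> \<and> upper I \<alpha> = L upper \<alpha>" by blast
  then have I: "e I \<alpha> = L e \<alpha>" if "is_endpoint e" "\<alpha> \<in> {0..1}" for e \<alpha>
    using that by (auto simp: is_endpoint_def)
  have "has_fuzzy_integral g I a b"
    unfolding has_fuzzy_integral_iff
  proof (intro allI impI)
    fix \<epsilon> :: real assume "\<epsilon> > 0"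
    then have "\<epsilon> / 2 > 0" by simp
    obtain \<delta> where "\<delta> > 0" and
      \<delta>: "\<forall>n t \<xi>. fine_partition a b \<delta> n t \<xi> \<longrightarrow>
        (\<forall>e \<alpha>. is_endpoint e \<longrightarrow> \<alpha> \<in> {0..1} \<longrightarrow>
          \<bar>e (\<Sum>i=1..n. (t i - t (i - 1)) *\<^sub>R g (\<xi> i)) \<alpha> - L e \<alpha>\<bar> \<le> \<epsilon> / 2)"
      using riemann_sum_endpoints_uniform[OF ab g \<open>\<epsilon> / 2 > 0\<close>] unfolding L_def by blast
    have "dist (\<Sum>i=1..n. (t i - t (i - 1)) *\<^sub>R g (\<xi> i)) I < \<epsilon>"
      if p: "fine_partition a b \<delta> n t \<xi>" for n t \<xi>
    proof -
      \<comment> \<open>Passing to the supremum over levels preserves only a weak inequality, hence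
        the bound \<open>\<epsilon> / 2\<close>.\<close>
      have "dist (\<Sum>i=1..n. (t i - t (i - 1)) *\<^sub>R g (\<xi> i)) I \<le> \<epsilon> / 2"
        by (rule dist_fuzzy_le) (use \<delta> p in \<open>simp_all add: I del: One_nat_def\<close>)
      with \<open>\<epsilon> > 0\<close> show ?thesis by simp
    qed
    with \<open>\<delta> > 0\<close> show "\<exists>\<delta>>0. \<forall>n t \<xi>. fine_partition a b \<delta> n t \<xi> \<longrightarrow>
        dist (\<Sum>i=1..n. (t i - t (i - 1)) *\<^sub>R g (\<xi> i)) I < \<epsilon>"
      by blast
  qed
  with I show ?thesis unfolding L_def by blast
qed

text \<open>Uniqueness identifies the definite description in \<open>fuzzy_integral\<close> with the
  integral just constructed, so endpoints commute with integration.\<close>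

corollary
  assumes "a < b" "continuous_on {a..b} g"
  shows fuzzy_integrable_continuous: "fuzzy_integrable g a b"
    and endpoint_fuzzy_integral: "is_endpoint e \<Longrightarrow> \<alpha> \<in> {0..1} \<Longrightarrow>
      e (fuzzy_integral g a b) \<alpha> = integral {a..b} (\<lambda>x. e (g x) \<alpha>)"
proof -
  obtain I where I: "has_fuzzy_integral g I a b"
    "\<And>e \<alpha>. is_endpoint e \<Longrightarrow> \<alpha> \<in> {0..1} \<Longrightarrow> e I \<alpha> = integral {a..b} (\<lambda>x. e (g x) \<alpha>)"
    using has_fuzzy_integral_continuous[OF assms] by blast
  then show "fuzzy_integrable g a b" unfolding fuzzy_integrable_def by blast
  have "fuzzy_integral g a b = I" unfolding fuzzy_integral_def
    by (rule the_equality[of "\<lambda>I. has_fuzzy_integral g I a b", OF I(1)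
          has_fuzzy_integral_unique[OF _ I(1) assms(1)]])
  then show "is_endpoint e \<Longrightarrow> \<alpha> \<in> {0..1} \<Longrightarrow>
      e (fuzzy_integral g a b) \<alpha> = integral {a..b} (\<lambda>x. e (g x) \<alpha>)"
    by (simp add: I(2))
qed

text \<open>The usual product estimate. Fuzzy numbers do not form a normed space, so
  \<open>dist (g x) 0\<close> takes the place of the norm of \<open>g x\<close>.\<close>

lemma continuous_on_scaleR_fuzzy:
  fixes c :: "'a::topological_space \<Rightarrow> real" and g :: "'a \<Rightarrow> fuzzy"
  assumes "continuous_on S c" "continuous_on S g" and pos: "\<And>x. x \<in> S \<Longrightarrow> 0 \<le> c x"
  shows "continuous_on S (\<lambda>x. c x *\<^sub>R g x)"
  unfolding continuous_on_def
proof
  fix x assume x: "x \<in> S"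
  have le: "dist (c y *\<^sub>R g y) (c x *\<^sub>R g x) \<le> c y * dist (g y) (g x) + \<bar>c y - c x\<bar> * dist (g x) 0"
    if y: "y \<in> S" for y
  proof -
    have "\<bar>e (c y *\<^sub>R g y) \<alpha> - e (c x *\<^sub>R g x) \<alpha>\<bar>
      \<le> c y * dist (g y) (g x) + \<bar>c y - c x\<bar> * dist (g x) 0"
      if e: "is_endpoint e" "\<alpha> \<in> {0..1}" for e \<alpha>
    proof -
      \<comment> \<open>Subtracting \<open>e 0 \<alpha>\<close>, which is zero, makes the last
        factor a difference to which the Lipschitz bound applies.\<close>
      have "\<bar>e (c y *\<^sub>R g y) \<alpha> - e (c x *\<^sub>R g x) \<alpha>\<bar>
          = \<bar>c y * (e (g y) \<alpha> - e (g x) \<alpha>) + (c y - c x) * (e (g x) \<alpha> - e 0 \<alpha>)\<bar>"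
        by (simp add: endpoint_scaleR[OF e] endpoint_zero[OF e] pos x y algebra_simps)
      also have "\<dots> \<le> c y * \<bar>e (g y) \<alpha> - e (g x) \<alpha>\<bar> + \<bar>c y - c x\<bar> * \<bar>e (g x) \<alpha> - e 0 \<alpha>\<bar>"
        by (rule order_trans[OF abs_triangle_ineq]) (simp add: abs_mult pos y)
      also have "\<dots> \<le> c y * dist (g y) (g x) + \<bar>c y - c x\<bar> * dist (g x) 0"
        by (intro add_mono mult_left_mono endpoint_lipschitz e pos y) auto
      finally show ?thesis .
    qed
    then show ?thesis by (intro dist_fuzzy_le) simp_all
  qed
  have "((\<lambda>y. c y * dist (g y) (g x) + \<bar>c y - c x\<bar> * dist (g x) 0) \<longlongrightarrow>
      c x * dist (g x) (g x) + \<bar>c x - c x\<bar> * dist (g x) 0) (at x within S)"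
    using assms(1,2) x by (intro tendsto_intros) (auto simp: continuous_on_def)
  then have lim: "((\<lambda>y. c y * dist (g y) (g x) + \<bar>c y - c x\<bar> * dist (g x) 0) \<longlongrightarrow> 0) (at x within S)"
    by simp
  show "((\<lambda>x. c x *\<^sub>R g x) \<longlongrightarrow> c x *\<^sub>R g x) (at x within S)"
    unfolding tendsto_dist_iff[of _ "c x *\<^sub>R g x"]
    by (rule tendsto_sandwich[OF _ _ tendsto_const lim])
      (use le in \<open>auto simp: eventually_at_filter\<close>)
qed

section \<open>The Poisson kernel\<close>

text \<open>For \<open>a \<le> b\<close>, split the integral over \<open>{a..b + T}\<close> once at
  \<open>a + T\<close> and once at \<open>b\<close>: the pieces over \<open>{a + T..b + T}\<close>
  and \<open>{a..b}\<close> agree by periodicity.\<close>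

lemma periodic_integral_shift:
  fixes h :: "real \<Rightarrow> real"
  assumes h: "continuous_on UNIV h" and per: "\<And>y. h (y + T) = h y" and "0 \<le> T"
  shows "integral {a..a + T} h = integral {b..b + T} h"
proof -
  have *: "integral {a..a + T} h = integral {b..b + T} h" if "a \<le> b" for a b
  proof -
    have int: "h integrable_on {a..b + T}"
      by (rule integrable_continuous_interval[OF continuous_on_subset[OF h]]) simp
    have "h \<circ> (+) T = h" using per by (auto simp: add.commute)
    then have "integral {a + T..b + T} h = integral {a..b} h"
      using integral_shift_Icc_real[of a b h T] by simp
    then show ?thesis
      using Henstock_Kurzweil_Integration.integral_combine[OF _ _ int, of "a + T"]
        Henstock_Kurzweil_Integration.integral_combine[OF _ _ int, of b] that \<open>0 \<le> T\<close>
      by simp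
  qed
  show ?thesis using *[of a b] *[of b a] by linarith
qed

text \<open>The substitution \<open>y = x - t\<close> leads to the period centred at
  \<open>x\<close>, which is then shifted back. It turns a convolution over \<open>f (x - t)\<close>
  into an integral over \<open>f y\<close>, as in the Fourier coefficients.\<close>

lemma periodic_integral_reflect:
  fixes h :: "real \<Rightarrow> real"
  assumes h: "continuous_on UNIV h" and per: "\<And>y. h (y + 2 * pi) = h y"
  shows "integral {-pi..pi} (\<lambda>t. h (x - t)) = integral {-pi..pi} h"
proof -
  have "integral {-pi..pi} (\<lambda>t. h (x - t)) = integral {-pi..pi} (h \<circ> (+) x)"
    using Henstock_Kurzweil_Integration.integral_reflect_real[of pi "-pi" "\<lambda>t. h (x + t)"] by (simp add: comp_def)
  also have "\<dots> = integral {x - pi..x + pi} h"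
    using integral_shift_Icc_real[of "-pi" pi h x] by (simp add: add.commute)
  also have "\<dots> = integral {-pi..pi} h"
    using periodic_integral_shift[OF h per, of "x - pi" "-pi"] by (simp add: add.commute)
  finally show ?thesis .
qed

section \<open>The kernel: positivity, cosine series and mass\<close>

text \<open>Normalised to mean value 1 over a period; the factor \<open>1 / (2 * pi)\<close> stays
  outside.\<close>

definition poisson_kernel :: "real \<Rightarrow> real \<Rightarrow> real" where
  "poisson_kernel r t = (1 - r\<^sup>2) / (1 - 2 * r * cos t + r\<^sup>2)"

context
  fixes r :: real
  assumes r: "0 \<le> r" "r < 1"
begin

text \<open>The denominator equals \<open>(1 - r)\<^sup>2 + 2 * r * (1 - cos t)\<close>. Dropping
  the square gives this bound; keeping it gives positivity in the next lemma.\<close>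

lemma poisson_denominator_ge: "2 * r * (1 - cos t) \<le> 1 - 2 * r * cos t + r\<^sup>2"
proof -
  have "0 \<le> (1 - r)\<^sup>2" by simp
  then show ?thesis by (simp add: power2_eq_square algebra_simps)
qed

lemma poisson_denominator_pos: "0 < 1 - 2 * r * cos t + r\<^sup>2"
proof -
  have "0 < (1 - r)\<^sup>2" using r by simp
  moreover have "0 \<le> r * (1 - cos t)" using r by simp
  ultimately show ?thesis by (simp add: power2_eq_square algebra_simps)
qed

lemma poisson_numerator_nonneg: "0 \<le> 1 - r\<^sup>2"
  using r by (simp add: power_le_one)

lemma poisson_kernel_nonneg: "0 \<le> poisson_kernel r t"
  unfolding poisson_kernel_def
  using poisson_denominator_pos[of t] poisson_numerator_nonneg by simp

lemma continuous_on_poisson_kernel: "continuous_on S (\<lambda>t. poisson_kernel r (u t))"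
  if "continuous_on S u" for S :: "real set"
  unfolding poisson_kernel_def
  using poisson_denominator_pos
  by (intro continuous_intros that ballI) (metis less_irrefl)

text \<open>The Poisson kernel is twice the real part of the geometric series of \<open>r e\<^sup>i\<^sup>t\<close>, minus one.\<close>
lemma poisson_kernel_sums:
  "(\<lambda>n. (if n = 0 then 1 else 2) * r ^ n * cos (real n * t)) sums poisson_kernel r t"
proof -
  define z where "z = complex_of_real r * cis t"
  have "norm z < 1" using r by (simp add: z_def norm_mult)
  then have "(\<lambda>n. Re (z ^ n)) sums Re (1 / (1 - z))"
    by (intro sums_Re geometric_sums)
  moreover have "Re (z ^ n) = r ^ n * cos (real n * t)" for n
    by (simp add: z_def power_mult_distrib Complex.DeMoivre flip: of_real_power)
  moreover have "Re (1 / (1 - z)) = (1 - r * cos t) / (1 - 2 * r * cos t + r\<^sup>2)"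
  proof -
    have "(cmod (1 - z))\<^sup>2 = (1 - r * cos t)\<^sup>2 + (r * sin t)\<^sup>2"
      by (simp add: z_def cmod_power2)
    also have "\<dots> = 1 - 2 * r * cos t + r\<^sup>2 * ((sin t)\<^sup>2 + (cos t)\<^sup>2)"
      unfolding power2_eq_square by (simp only: algebra_simps)
    finally have "(cmod (1 - z))\<^sup>2 = 1 - 2 * r * cos t + r\<^sup>2" by simp
    then show ?thesis by (simp add: Re_divide cmod_power2 z_def)
  qed
  ultimately have "(\<lambda>n. r ^ n * cos (real n * t)) sums
      ((1 - r * cos t) / (1 - 2 * r * cos t + r\<^sup>2))" by simp
  \<comment> \<open>Doubling gives the coefficient 2 also at \<open>n = 0\<close>; the subtracted
    one-term series corrects it to 1.\<close>
  from sums_diff[OF sums_mult[OF this, of 2] sums_single[of 0 "\<lambda>_. 1"]]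
  have "(\<lambda>n. (if n = 0 then 1 else 2) * r ^ n * cos (real n * t)) sums
      (2 * ((1 - r * cos t) / (1 - 2 * r * cos t + r\<^sup>2)) - 1)"
    by (rule sums_cong[THEN iffD1, rotated]) auto
  moreover have "2 * ((1 - r * cos t) / (1 - 2 * r * cos t + r\<^sup>2)) - 1 = poisson_kernel r t"
    using poisson_denominator_pos[of t] by (simp add: poisson_kernel_def field_simps)
  ultimately show ?thesis by simp
qed

text \<open>The cosine series of the kernel, multiplied by a bounded \<open>\<phi>\<close>, is
  dominated by a geometric series, so it converges uniformly and may be integrated term by
  term.\<close>

lemma poisson_convolution_sums:
  fixes \<phi> :: "real \<Rightarrow> real"
  assumes \<phi>: "continuous_on {a..b} \<phi>"
  shows "(\<lambda>n. (if n = 0 then 1 else 2) * r ^ n * integral {a..b} (\<lambda>y. \<phi> y * cos (real n * (x - y))))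
    sums integral {a..b} (\<lambda>y. \<phi> y * poisson_kernel r (x - y))"
proof -
  define F where "F n y = (if n = 0 then 1 else 2) * r ^ n * (\<phi> y * cos (real n * (x - y)))" for n y
  have contF: "continuous_on {a..b} (F n)" for n
    unfolding F_def by (intro continuous_intros \<phi>)
  have "bounded (\<phi> ` {a..b})"
    by (intro compact_imp_bounded compact_continuous_image \<phi>) simp
  then obtain B where B: "\<forall>y\<in>{a..b}. \<bar>\<phi> y\<bar> \<le> B"
    by (auto simp only: bounded_iff ball_simps real_norm_def)
  have "uniform_limit {a..b} (\<lambda>n y. \<Sum>i<n. F i y) (\<lambda>y. \<Sum>i. F i y) sequentially"
  proof (rule Weierstrass_m_test)
    show "summable (\<lambda>n. 2 * r ^ n * B)"
      using r by (intro summable_mult summable_mult2 summable_geometric) simp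
    fix n y assume y: "y \<in> {a..b}"
    have *: "\<bar>\<phi> y\<bar> * \<bar>cos (real n * (x - y))\<bar> \<le> B * 1"
      by (rule mult_mono) (use B y in auto)
    have "\<bar>if n = 0 then 1 else 2\<bar> * \<bar>r ^ n\<bar> * (\<bar>\<phi> y\<bar> * \<bar>cos (real n * (x - y))\<bar>) \<le> 2 * r ^ n * (B * 1)"
      using r by (intro mult_mono[OF _ *]) auto
    then show "norm (F n y) \<le> 2 * r ^ n * B"
      by (simp add: F_def abs_mult)
  qed
  then obtain I J where I: "\<And>n. ((\<lambda>y. \<Sum>i<n. F i y) has_integral I n) {a..b}"
    and J: "((\<lambda>y. \<Sum>i. F i y) has_integral J) {a..b}" and IJ: "I \<longlonglongrightarrow> J"
    by (rule uniform_limit_integral) (auto intro!: continuous_on_sum contF)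
  have "I = (\<lambda>n. \<Sum>i<n. integral {a..b} (F i))"
  proof
    show "I n = (\<Sum>i<n. integral {a..b} (F i))" for n
      using integral_unique[OF I[of n]]
      by (simp add: integral_sum integrable_continuous_interval contF)
  qed
  with IJ have "(\<lambda>n. integral {a..b} (F n)) sums J"
    by (simp add: sums_def)
  moreover have "(\<Sum>i. F i y) = \<phi> y * poisson_kernel r (x - y)" for y
    using sums_mult[OF poisson_kernel_sums[of "x - y"], of "\<phi> y"]
    by (intro sums_unique[symmetric]) (simp add: F_def mult_ac)
  then have "J = integral {a..b} (\<lambda>y. \<phi> y * poisson_kernel r (x - y))"
    using integral_unique[OF J] by simp
  moreover have "integral {a..b} (F n) = (if n = 0 then 1 else 2) * r ^ n *
      integral {a..b} (\<lambda>y. \<phi> y * cos (real n * (x - y)))" for n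
    unfolding F_def by (rule integral_mult_right)
  ultimately show ?thesis by simp
qed

text \<open>The convolution series for the constant 1 at the point 0: cosines of positive frequency
  integrate to zero, so only the term at \<open>n = 0\<close> survives.\<close>

lemma integral_poisson_kernel: "integral {-pi..pi} (poisson_kernel r) = 2 * pi"
proof -
  have "integral {-pi..pi} (\<lambda>y. cos (real n * y)) = 0" if "n \<noteq> 0" for n
  proof -
    have "((\<lambda>y. cos (real n * y)) has_integral
        sin (real n * pi) / real n - sin (real n * - pi) / real n) {-pi..pi}"
      using that
      by (intro fundamental_theorem_of_calculus)
        (auto intro!: derivative_eq_intros simp flip: has_real_derivative_iff_has_vector_derivative)
    then show ?thesis by (simp add: integral_unique)
  qed
  then have "(if n = 0 then 1 else 2) * r ^ n * integral {-pi..pi} (\<lambda>y. 1 * cos (real n * (0 - y)))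
      = (if n = 0 then 2 * pi else 0)" for n
    by simp
  then have "(\<lambda>n. if n = 0 then 2 * pi else 0) sums
      integral {-pi..pi} (\<lambda>y. 1 * poisson_kernel r (0 - y))"
    using poisson_convolution_sums[of "-pi" pi "\<lambda>_. 1" 0] by simp
  moreover have "poisson_kernel r (0 - y) = poisson_kernel r y" for y
    by (simp add: poisson_kernel_def)
  ultimately show ?thesis
    using sums_unique2[OF _ sums_single[of 0 "\<lambda>_. 2 * pi"]] by simp
qed

end

text \<open>The mass of the kernel away from \<open>0\<close> is controlled by the test function \<open>1 - cos t\<close>:
  \<open>\<psi>\<close> is at most \<open>\<epsilon> + C (1 - cos t)\<close>, and the kernel times \<open>1 - cos t\<close> is at most \<open>(1 - r\<^sup>2) / (2 r)\<close>.\<close>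
lemma poisson_approximate_identity:
  fixes \<psi> :: "real \<Rightarrow> real"
  assumes \<psi>: "continuous_on {-pi..pi} \<psi>" and nonneg: "\<And>t. 0 \<le> \<psi> t" and zero: "\<psi> 0 = 0"
  shows "((\<lambda>r. integral {-pi..pi} (\<lambda>t. poisson_kernel r t * \<psi> t)) \<longlongrightarrow> 0) (at_left 1)"
proof (rule tendstoI)
  fix \<eta> :: real assume "\<eta> > 0"
  \<comment> \<open>Against the kernel mass \<open>2 * pi\<close> this contributes
    \<open>\<eta> / 2\<close>.\<close>
  define \<epsilon> where "\<epsilon> = \<eta> / (4 * pi)"
  have "\<epsilon> > 0" using \<open>\<eta> > 0\<close> by (simp add: \<epsilon>_def)
  obtain d where d: "d > 0" "\<And>t. t \<in> {-pi..pi} \<Longrightarrow> \<bar>t\<bar> < d \<Longrightarrow> \<psi> t < \<epsilon>"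
  proof -
    obtain d where "d > 0" "\<And>t. t \<in> {-pi..pi} \<Longrightarrow> dist t 0 < d \<Longrightarrow> dist (\<psi> t) (\<psi> 0) < \<epsilon>"
      using \<psi>[unfolded continuous_on_iff, rule_format, of 0 \<epsilon>] \<open>\<epsilon> > 0\<close> by auto
    with that show ?thesis using nonneg zero by (simp add: dist_real_def)
  qed
  \<comment> \<open>The cap at \<open>pi\<close> keeps \<open>\<delta>\<close> in the range where
    cosine decreases.\<close>
  define \<delta> where "\<delta> = min d pi"
  have \<delta>: "0 < \<delta>" "\<delta> \<le> pi" using d by (auto simp: \<delta>_def)
  then have cos\<delta>: "cos \<delta> < 1" using cos_monotone_0_pi[of 0 \<delta>] by simp
  have "bounded (\<psi> ` {-pi..pi})"
    by (intro compact_imp_bounded compact_continuous_image \<psi>) simp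
  then obtain M where "\<forall>t\<in>{-pi..pi}. \<bar>\<psi> t\<bar> \<le> M"
    by (auto simp only: bounded_iff ball_simps real_norm_def)
  then have M: "\<psi> t \<le> M" if "t \<in> {-pi..pi}" for t using that by (auto simp: abs_le_iff)
  have "0 \<le> M" using M[of 0] zero by simp
  \<comment> \<open>Makes \<open>C * (1 - cos t)\<close> at least the bound \<open>M\<close> once
    \<open>\<delta> \<le> \<bar>t\<bar> \<le> pi\<close>.\<close>
  define C where "C = M / (1 - cos \<delta>)"
  have "0 \<le> C" using \<open>0 \<le> M\<close> cos\<delta> by (simp add: C_def)
  have le: "\<psi> t \<le> \<epsilon> + C * (1 - cos t)" if t: "t \<in> {-pi..pi}" for t
  proof (cases "\<bar>t\<bar> < \<delta>")
    case True
    then have "\<psi> t < \<epsilon>" using d(2)[OF t] by (simp add: \<delta>_def)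
    moreover have "0 \<le> C * (1 - cos t)" using \<open>0 \<le> C\<close> by simp
    ultimately show ?thesis by linarith
  next
    case False
    then have "cos \<bar>t\<bar> \<le> cos \<delta>"
      using t \<delta> by (intro cos_monotone_0_pi_le) auto
    then have "C * (1 - cos \<delta>) \<le> C * (1 - cos t)"
      using \<open>0 \<le> C\<close> by (intro mult_left_mono) (auto simp: abs_if split: if_splits)
    moreover have "C * (1 - cos \<delta>) = M" using cos\<delta> by (simp add: C_def)
    ultimately show ?thesis using M[OF t] \<open>\<epsilon> > 0\<close> by linarith
  qed
  have bound: "\<bar>integral {-pi..pi} (\<lambda>t. poisson_kernel r t * \<psi> t)\<bar>
      \<le> \<eta> / 2 + 2 * pi * (C * ((1 - r\<^sup>2) / (2 * r)))" if r: "0 < r" "r < 1" for r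
  proof -
    have r0: "0 \<le> r" using r by simp
    note K = continuous_on_poisson_kernel[OF r0 r(2) continuous_on_id]
    note int = integrable_continuous_interval
    have "integral {-pi..pi} (\<lambda>t. poisson_kernel r t * \<psi> t)
        \<le> integral {-pi..pi} (\<lambda>t. \<epsilon> * poisson_kernel r t + C * ((1 - r\<^sup>2) / (2 * r)))"
    proof (rule integral_le)
      show "(\<lambda>t. poisson_kernel r t * \<psi> t) integrable_on {-pi..pi}"
        "(\<lambda>t. \<epsilon> * poisson_kernel r t + C * ((1 - r\<^sup>2) / (2 * r))) integrable_on {-pi..pi}"
        by (intro int continuous_intros K \<psi>)+
      fix t assume t: "t \<in> {-pi..pi}"
      note pos = poisson_denominator_pos[OF r0 r(2), of t]
      \<comment> \<open>Inserts the factor \<open>2 * r\<close> so that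
        \<open>poisson_denominator_ge\<close> bounds the remaining quotient by 1.\<close>
      have "N / D * w = N / (2 * r) * (2 * r * w / D)" for N D w
        using r by simp
      then have "poisson_kernel r t * (1 - cos t)
          = (1 - r\<^sup>2) / (2 * r) * (2 * r * (1 - cos t) / (1 - 2 * r * cos t + r\<^sup>2))"
        unfolding poisson_kernel_def .
      also have "\<dots> \<le> (1 - r\<^sup>2) / (2 * r) * 1"
        using r poisson_numerator_nonneg[OF r0 r(2)] poisson_denominator_ge[OF r0 r(2), of t] pos
        by (intro mult_left_mono) auto
      finally have "C * (poisson_kernel r t * (1 - cos t)) \<le> C * ((1 - r\<^sup>2) / (2 * r))"
        using \<open>0 \<le> C\<close> by (intro mult_left_mono) auto
      moreover have "poisson_kernel r t * \<psi> t \<le> poisson_kernel r t * (\<epsilon> + C * (1 - cos t))"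
        by (intro mult_left_mono le[OF t] poisson_kernel_nonneg[OF r0 r(2)])
      ultimately show "poisson_kernel r t * \<psi> t \<le> \<epsilon> * poisson_kernel r t + C * ((1 - r\<^sup>2) / (2 * r))"
        by (simp add: algebra_simps)
    qed
    also have "\<dots> = integral {-pi..pi} (\<lambda>t. \<epsilon> * poisson_kernel r t)
        + integral {-pi..pi} (\<lambda>t. C * ((1 - r\<^sup>2) / (2 * r)))"
      by (intro integral_add int continuous_intros K)
    also have "\<dots> = \<eta> / 2 + 2 * pi * (C * ((1 - r\<^sup>2) / (2 * r)))"
      using integral_poisson_kernel[OF r0 r(2)] by (simp add: \<epsilon>_def)
    finally show ?thesis
      using integral_nonneg[OF int[OF continuous_on_mult[OF K \<psi>]]]
        poisson_kernel_nonneg[OF r0 r(2)] nonneg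
      by simp
  qed
  have "((\<lambda>r. \<eta> / 2 + 2 * pi * (C * ((1 - r\<^sup>2) / (2 * r)))) \<longlongrightarrow>
      \<eta> / 2 + 2 * pi * (C * ((1 - 1\<^sup>2) / (2 * 1)))) (at_left 1)"
    by (intro tendsto_intros) simp
  then have "((\<lambda>r. \<eta> / 2 + 2 * pi * (C * ((1 - r\<^sup>2) / (2 * r)))) \<longlongrightarrow> \<eta> / 2) (at_left 1)"
    by simp
  then have "\<forall>\<^sub>F r in at_left 1. \<eta> / 2 + 2 * pi * (C * ((1 - r\<^sup>2) / (2 * r))) < \<eta>"
    by (rule order_tendstoD(2)) (use \<open>\<eta> > 0\<close> in simp)
  moreover have "\<forall>\<^sub>F r in at_left 1. 0 < r \<and> r < (1::real)"
    by (auto simp: eventually_at_left[of 0] intro!: exI[of _ 0])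
  ultimately show "\<forall>\<^sub>F r in at_left 1. dist (integral {-pi..pi} (\<lambda>t. poisson_kernel r t * \<psi> t)) 0 < \<eta>"
  proof eventually_elim
    case (elim r)
    then show ?case using bound[of r] by simp
  qed
qed

section \<open>Abel means of the level Fourier series\<close>

text \<open>The addition theorem for cosine merges the two coefficients. The factor 1 at
  \<open>n = 0\<close> reflects the halved constant term and matches the coefficients of the kernel
  series.\<close>

lemma fourier_term_eq_integral:
  assumes e: "is_endpoint e" "\<alpha> \<in> {0..1}" and f: "continuous_on UNIV f"
  shows "fourier_term e f n \<alpha> x = (if n = 0 then 1 else 2) / (2 * pi) *
    integral {-pi..pi} (\<lambda>y. e (f y) \<alpha> * cos (real n * (x - y)))"
proof (cases "n = 0")
  case True
  then show ?thesis by (simp add: fourier_term_def fourier_a_def)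
next
  case False
  have \<phi>: "continuous_on {-pi..pi} (\<lambda>y. e (f y) \<alpha>)"
    by (rule endpoint_continuous_on[OF e continuous_on_subset[OF f]]) simp
  have "integral {-pi..pi} (\<lambda>y. e (f y) \<alpha> * cos (real n * (x - y)))
      = integral {-pi..pi} (\<lambda>y. cos (real n * x) * (e (f y) \<alpha> * cos (real n * y))
          + sin (real n * x) * (e (f y) \<alpha> * sin (real n * y)))"
    by (rule integral_cong) (simp add: right_diff_distrib cos_diff algebra_simps)
  also have "\<dots> = integral {-pi..pi} (\<lambda>y. cos (real n * x) * (e (f y) \<alpha> * cos (real n * y)))
      + integral {-pi..pi} (\<lambda>y. sin (real n * x) * (e (f y) \<alpha> * sin (real n * y)))"
    by (intro integral_add integrable_continuous_interval continuous_intros \<phi>)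
  finally show ?thesis
    using False by (simp add: fourier_term_def fourier_a_def fourier_b_def add_divide_distrib mult.commute)
qed

context
  fixes f :: "real \<Rightarrow> fuzzy" and s :: real
  assumes f: "continuous_on UNIV f" and s: "0 < s"
begin

lemma exp_minus_bounds: "0 \<le> exp (- s)" "exp (- s) < 1"
  using s by auto

lemma exp_minus_2: "exp (- 2 * s) = (exp (- s))\<^sup>2"
  by (simp flip: exp_double)

lemma poisson_integrand_continuous:
  "continuous_on {-pi..pi}
    (\<lambda>t. (1 / (1 - 2 * exp (- s) * cos t + exp (- 2 * s))) *\<^sub>R f (x - t))"
proof (rule continuous_on_scaleR_fuzzy)
  note pos = poisson_denominator_pos[OF exp_minus_bounds]
  show "continuous_on {-pi..pi} (\<lambda>t. 1 / (1 - 2 * exp (- s) * cos t + exp (- 2 * s)))"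
    unfolding exp_minus_2 using pos
    by (intro continuous_intros ballI) (metis less_irrefl)
  show "continuous_on {-pi..pi} (\<lambda>t. f (x - t))"
    by (intro continuous_on_compose2[OF f] continuous_intros) simp
  show "0 \<le> 1 / (1 - 2 * exp (- s) * cos t + exp (- 2 * s))" for t
    unfolding exp_minus_2 using pos[of t] by simp
qed

text \<open>Both scalar factors are nonnegative, so the endpoint passes through the outer factor,
  the integral and the inner factor; the numerator then moves inside to complete the kernel.\<close>

lemma endpoint_abel_poisson_integral:
  assumes e: "is_endpoint e" "\<alpha> \<in> {0..1}"
  shows "e (abel_poisson_integral f s x) \<alpha> =
    1 / (2 * pi) * integral {-pi..pi} (\<lambda>t. poisson_kernel (exp (- s)) t * e (f (x - t)) \<alpha>)"
proof -
  note pos = poisson_denominator_pos[OF exp_minus_bounds]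
  have "0 \<le> (1 - exp (- 2 * s)) / (2 * pi)" using s by simp
  then have "e (abel_poisson_integral f s x) \<alpha> = (1 - exp (- 2 * s)) / (2 * pi) *
      e (fuzzy_integral
        (\<lambda>t. (1 / (1 - 2 * exp (- s) * cos t + exp (- 2 * s))) *\<^sub>R f (x - t)) (- pi) pi) \<alpha>"
    unfolding abel_poisson_integral_def by (rule endpoint_scaleR[OF e])
  also have "e (fuzzy_integral
        (\<lambda>t. (1 / (1 - 2 * exp (- s) * cos t + exp (- 2 * s))) *\<^sub>R f (x - t)) (- pi) pi) \<alpha>
      = integral {-pi..pi} (\<lambda>t. e ((1 / (1 - 2 * exp (- s) * cos t + exp (- 2 * s))) *\<^sub>R f (x - t)) \<alpha>)"
    by (rule endpoint_fuzzy_integral[OF _ poisson_integrand_continuous e]) simp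
  also have "(1 - exp (- 2 * s)) / (2 * pi) * \<dots> = 1 / (2 * pi) * ((1 - exp (- 2 * s)) *
      integral {-pi..pi} (\<lambda>t. 1 / (1 - 2 * exp (- s) * cos t + exp (- 2 * s)) * e (f (x - t)) \<alpha>))"
    unfolding exp_minus_2 using pos
    by (simp add: endpoint_scaleR[OF e] less_imp_le)
  also have "\<dots> = 1 / (2 * pi) * integral {-pi..pi} (\<lambda>t. (1 - exp (- 2 * s)) *
      (1 / (1 - 2 * exp (- s) * cos t + exp (- 2 * s)) * e (f (x - t)) \<alpha>))"
    by (simp only: integral_mult_right)
  finally show ?thesis unfolding exp_minus_2 by (simp add: poisson_kernel_def)
qed

text \<open>After the substitution \<open>y = x - t\<close>, justified by periodicity of
  \<open>h\<close>, the integral is the convolution whose expansion has the damped Fourier terms as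
  summands, since \<open>exp (- real n * s)\<close> is the \<open>n\<close>-th power of
  \<open>exp (- s)\<close>.\<close>

lemma fourier_abel_means_sums:
  assumes per: "\<And>x. f (x + 2 * pi) = f x" and e: "is_endpoint e" "\<alpha> \<in> {0..1}"
  shows "(\<lambda>n. fourier_term e f n \<alpha> x * exp (- real n * s)) sums e (abel_poisson_integral f s x) \<alpha>"
proof -
  have \<phi>: "continuous_on S (\<lambda>y. e (f y) \<alpha>)" for S
    by (rule endpoint_continuous_on[OF e continuous_on_subset[OF f]]) simp
  define h where "h y = e (f y) \<alpha> * poisson_kernel (exp (- s)) (x - y)" for y
  have "h (y + 2 * pi) = h y" for y
  proof -
    have "cos (x - (y + 2 * pi)) = cos (x - y)"
      using cos_periodic[of "x - y - 2 * pi"] by (simp add: algebra_simps)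
    then show ?thesis by (simp only: h_def per poisson_kernel_def)
  qed
  moreover have "continuous_on UNIV h" unfolding h_def
    by (intro continuous_intros \<phi> continuous_on_poisson_kernel[OF exp_minus_bounds])
  ultimately have "integral {-pi..pi} (\<lambda>t. h (x - t)) = integral {-pi..pi} h"
    by (intro periodic_integral_reflect)
  then have eq: "e (abel_poisson_integral f s x) \<alpha> = 1 / (2 * pi) * integral {-pi..pi} h"
    by (simp add: endpoint_abel_poisson_integral[OF e] h_def mult.commute)
  have "exp (- real n * s) = exp (- s) ^ n" for n
    using exp_of_nat_mult[of n "- s"] by simp
  then have "fourier_term e f n \<alpha> x * exp (- real n * s) = 1 / (2 * pi) *
      ((if n = 0 then 1 else 2) * exp (- s) ^ n *
        integral {-pi..pi} (\<lambda>y. e (f y) \<alpha> * cos (real n * (x - y))))" for n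
    by (simp add: fourier_term_eq_integral[OF e f])
  then show ?thesis
    using sums_mult[OF poisson_convolution_sums[OF exp_minus_bounds \<phi>[of "{-pi..pi}"], of x],
        of "1 / (2 * pi)"]
    unfolding eq h_def by (simp only:)
qed

section \<open>Convergence to \<open>f x\<close> as \<open>s\<close> tends to 0\<close>

text \<open>By the mass of the kernel, \<open>e (f x) \<alpha>\<close> is its own Poisson mean, so
  the difference moves under the integral. The Lipschitz bound there is free of
  \<open>\<alpha>\<close> and survives the supremum over levels.\<close>

lemma dist_abel_poisson_integral_le:
  "dist (abel_poisson_integral f s x) (f x) \<le>
    1 / (2 * pi) * integral {-pi..pi} (\<lambda>t. poisson_kernel (exp (- s)) t * dist (f (x - t)) (f x))"
proof -
  let ?K = "poisson_kernel (exp (- s))"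
  note K = continuous_on_poisson_kernel[OF exp_minus_bounds continuous_on_id]
  note int = integrable_continuous_interval
  have fx: "continuous_on {-pi..pi} (\<lambda>t. f (x - t))"
    by (intro continuous_on_compose2[OF f] continuous_intros) simp
  have "\<bar>e (abel_poisson_integral f s x) \<alpha> - e (f x) \<alpha>\<bar> \<le>
      1 / (2 * pi) * integral {-pi..pi} (\<lambda>t. ?K t * dist (f (x - t)) (f x))"
    if e: "is_endpoint e" "\<alpha> \<in> {0..1}" for e \<alpha>
  proof -
    note \<phi> = endpoint_continuous_on[OF e fx]
    have "e (abel_poisson_integral f s x) \<alpha> - e (f x) \<alpha>
        = 1 / (2 * pi) * (integral {-pi..pi} (\<lambda>t. ?K t * e (f (x - t)) \<alpha>) - 2 * pi * e (f x) \<alpha>)"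
      by (simp add: endpoint_abel_poisson_integral[OF e] right_diff_distrib)
    also have "2 * pi * e (f x) \<alpha> = integral {-pi..pi} (\<lambda>t. ?K t * e (f x) \<alpha>)"
      using integral_poisson_kernel[OF exp_minus_bounds] by simp
    also have "integral {-pi..pi} (\<lambda>t. ?K t * e (f (x - t)) \<alpha>) - \<dots>
        = integral {-pi..pi} (\<lambda>t. ?K t * e (f (x - t)) \<alpha> - ?K t * e (f x) \<alpha>)"
      by (intro integral_diff[symmetric] int continuous_intros K \<phi>)
    finally have "\<bar>e (abel_poisson_integral f s x) \<alpha> - e (f x) \<alpha>\<bar>
        = 1 / (2 * pi) * norm (integral {-pi..pi} (\<lambda>t. ?K t * e (f (x - t)) \<alpha> - ?K t * e (f x) \<alpha>))"
      by (simp add: abs_mult)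
    also have "\<dots> \<le> 1 / (2 * pi) * integral {-pi..pi} (\<lambda>t. ?K t * dist (f (x - t)) (f x))"
    proof (intro mult_left_mono integral_norm_bound_integral int continuous_intros K \<phi> fx)
      fix t
      have "norm (?K t * e (f (x - t)) \<alpha> - ?K t * e (f x) \<alpha>) = ?K t * \<bar>e (f (x - t)) \<alpha> - e (f x) \<alpha>\<bar>"
        using poisson_kernel_nonneg[OF exp_minus_bounds, of t]
        by (simp add: abs_mult flip: right_diff_distrib)
      also have "\<dots> \<le> ?K t * dist (f (x - t)) (f x)"
        by (intro mult_left_mono endpoint_lipschitz[OF e] poisson_kernel_nonneg exp_minus_bounds)
      finally show "norm (?K t * e (f (x - t)) \<alpha> - ?K t * e (f x) \<alpha>) \<le> ?K t * dist (f (x - t)) (f x)" .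
    qed simp
    finally show ?thesis .
  qed
  then show ?thesis by (intro dist_fuzzy_le) simp_all
qed

end

lemma abel_poisson_integral_tendsto:
  assumes f: "continuous_on UNIV f"
  shows "((\<lambda>s. abel_poisson_integral f s x) \<longlongrightarrow> f x) (at_right 0)"
proof -
  have "continuous_on {-pi..pi} (\<lambda>t. dist (f (x - t)) (f x))"
    by (intro continuous_intros continuous_on_compose2[OF f]) simp
  then have "((\<lambda>r. integral {-pi..pi} (\<lambda>t. poisson_kernel r t * dist (f (x - t)) (f x))) \<longlongrightarrow> 0) (at_left 1)"
    by (rule poisson_approximate_identity) simp_all
  \<comment> \<open>For \<open>s > 0\<close> the value \<open>exp (- s)\<close> stays below 1, so 1
    is approached from the left.\<close>
  moreover have "filterlim (\<lambda>s::real. exp (- s)) (at_left 1) (at_right 0)"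
  proof -
    have "((\<lambda>s::real. exp (- s)) \<longlongrightarrow> exp (- 0)) (at_right 0)" by (intro tendsto_intros)
    then show ?thesis by (auto simp: filterlim_at eventually_at_filter)
  qed
  ultimately have "((\<lambda>s. integral {-pi..pi} (\<lambda>t. poisson_kernel (exp (- s)) t * dist (f (x - t)) (f x)))
      \<longlongrightarrow> 0) (at_right 0)"
    by (rule filterlim_compose)
  from tendsto_mult_left[OF this, of "1 / (2 * pi)"]
  have "((\<lambda>s. 1 / (2 * pi) *
      integral {-pi..pi} (\<lambda>t. poisson_kernel (exp (- s)) t * dist (f (x - t)) (f x))) \<longlongrightarrow> 0) (at_right 0)"
    by simp
  then show ?thesis
    unfolding tendsto_dist_iff[of _ "f x"]
    by (rule tendsto_sandwich[OF _ _ tendsto_const, rotated 2])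
      (auto simp only: eventually_at_filter greaterThan_iff zero_le_dist eventually_True simp_thms
        intro!: always_eventually dist_abel_poisson_integral_le[OF f])
qed

text \<open>As \<open>fuzzy_integral\<close> is a definite description, integrability is asserted
  separately. The \<open>sums\<close> statements include convergence of the means, and by
  \<open>fuzzy_eqI\<close> the endpoints at all levels determine the fuzzy number.\<close>

theorem mainTheorem6:
  fixes f :: "real \<Rightarrow> fuzzy"
  assumes "continuous_on UNIV f"
    and "\<And>x. f (x + 2 * pi) = f x"
  shows "(\<forall>s>0. \<forall>x.
      fuzzy_integrable
        (\<lambda>t. (1 / (1 - 2 * exp (-s) * cos t + exp (-2 * s))) *\<^sub>R f (x - t)) (-pi) pi \<and>
      (\<forall>\<alpha>\<in>{0..1}.
        (\<lambda>n. fourier_term lower f n \<alpha> x * exp (- real n * s)) sums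
          lower (abel_poisson_integral f s x) \<alpha> \<and>
        (\<lambda>n. fourier_term upper f n \<alpha> x * exp (- real n * s)) sums
          upper (abel_poisson_integral f s x) \<alpha>)) \<and>
    (\<forall>x. ((\<lambda>s. abel_poisson_integral f s x) \<longlongrightarrow> f x) (at_right 0))"
proof (intro conjI allI impI ballI)
  show "fuzzy_integrable
      (\<lambda>t. (1 / (1 - 2 * exp (-s) * cos t + exp (-2 * s))) *\<^sub>R f (x - t)) (-pi) pi"
    if "s > 0" for s x
    by (rule fuzzy_integrable_continuous[OF _ poisson_integrand_continuous[OF assms(1) that]]) simp
qed (rule fourier_abel_means_sums abel_poisson_integral_tendsto assms is_endpoint_simps | assumption)+

end
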